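(* Let $\tau$ be a 2-BKP tau function and $a,b\in\{1,2\}$. Then for any constant $C_{ab}$, $$\widetilde\tau_{ab}:=\tau+C_{ab}\,X_{ab}(\lambda,\mu)\tau$$ is again a 2-BKP tau function.
   Context: Times: $\mathbf t=(t^{(1)},t^{(2)})$, $t^{(a)}=(t^{(a)}_1,t^{(a)}_3,\dots)$ (odd indices), $\partial_{a,n}=\partial/\partial t^{(a)}_n$. $\xi(t^{(a)},z)=\sum_{i\ge1}t^{(a)}_{2i-1}z^{2i-1}$, $\tilde\partial_{t^{(a)}}=(\partial_{a,1},\frac13\partial_{a,3},\dots)$, $[z^{-1}]=(z^{-1},z^{-3}/3,\dots)$, $[z^{-1}]_1=([z^{-1}],0)$, $[z^{-1}]_2=(0,[z^{-1}])$, $\mathrm{Res}_z\sum b_iz^i=b_{-1}$. A 2-BKP tau function satisfies for all $\mathbf t,\mathbf t'$: $\mathrm{Res}_z z^{-1}\tau(\mathbf t-2[z^{-1}]_1)\tau(\mathbf t'+2[z^{-1}]_1)e^{\xi(t^{(1)}-t'^{(1)},z)}=\mathrm{Res}_z z^{-1}\tau(\mathbf t-2[z^{-1}]_2)\tau(\mathbf t'+2[z^{-1}]_2)e^{\xi(t^{(2)}-t'^{(2)},z)}$. Vertex operators: $X_a(\lambda)=e^{\xi(t^{(a)},\lambda)}e^{-2\xi(\tilde\partial_{t^{(a)}},\lambda^{-1})}$, $X_{ab}(\lambda,\mu)=X_a(\mu)X_b(-\lambda)=\varepsilon_{ab}(\lambda,\mu)e^{\xi(t^{(a)},\mu)-\xi(t^{(b)},\lambda)}e^{-2\xi(\tilde\partial_{t^{(a)}},\mu^{-1})+2\xi(\tilde\partial_{t^{(b)}},\lambda^{-1})}$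 with $\varepsilon_{ab}=\frac{\mu+\lambda}{\mu-\lambda}$ if $a=b$, $\varepsilon_{ab}=1$ if $a\neq b$; $\lambda,\mu$ are parameters. *)

theory Defs
  imports "HOL-Library.Poly_Mapping" "HOL-Computational_Algebra.Formal_Laurent_Series"
begin

text \<open>
  Formal setting.  The two families of odd times t^(1), t^(2) are formal variables.
  The variable (a, i) :: tvar stands for t^(a)_(2i+1).  A (formal) function of the
  times with coefficients in a field 'k is a formal power series in these infinitely
  many variables, i.e. a map from monomials (finitely supported exponent vectors)
  to coefficients.
\<close>

datatype comp = Cmp1 | Cmp2

type_synonym tvar = "comp \<times> nat"
type_synonym mono = "tvar \<Rightarrow>\<^sub>0 nat"
type_synonym 'k tser = "mono \<Rightarrow> 'k"

definition oddidx :: "tvar \<Rightarrow> nat" where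
  "oddidx v = 2 * snd v + 1"

definition wt :: "mono \<Rightarrow> nat" where
  "wt e = (\<Sum>v\<in>Poly_Mapping.keys e. Poly_Mapping.lookup e v * oddidx v)"

definition deg :: "mono \<Rightarrow> nat" where
  "deg e = (\<Sum>v\<in>Poly_Mapping.keys e. Poly_Mapping.lookup e v)"

definition mfact :: "mono \<Rightarrow> nat" where
  "mfact e = (\<Prod>v\<in>Poly_Mapping.keys e. fact (Poly_Mapping.lookup e v))"

definition on_comp :: "comp \<Rightarrow> mono \<Rightarrow> bool" where
  "on_comp a e \<longleftrightarrow> (\<forall>v\<in>Poly_Mapping.keys e. fst v = a)"

text \<open>
  shiftc s a f k = coefficient of z^(-k) in the expansion of f(t + s [z^(-1)]_a),
  [z^(-1)] = (z^(-1), z^(-3)/3, ...) (Taylor expansion, a series in t).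
  Coefficient of t^m:  sum over e on component a with weight k of
  f_(m+e) * prod_v binom(m_v+e_v, e_v) * (s / n_v)^(e_v).
\<close>
definition shiftc :: "'k::field_char_0 \<Rightarrow> comp \<Rightarrow> 'k tser \<Rightarrow> nat \<Rightarrow> 'k tser" where
  "shiftc s a f k = (\<lambda>m. \<Sum>e\<in>{e. on_comp a e \<and> wt e = k}.
      f (m + e) * (\<Prod>v\<in>Poly_Mapping.keys e. of_nat ((Poly_Mapping.lookup m v + Poly_Mapping.lookup e v) choose Poly_Mapping.lookup e v)
                                 * (s / of_nat (oddidx v)) ^ Poly_Mapping.lookup e v))"

text \<open>
  bil_side f a m m' = coefficient of t^m t'^m' in
    Res_z z^(-1) f(t - 2[z^(-1)]_a) f(t' + 2[z^(-1)]_a) e^(xi(t^(a) - t'^(a), z)).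
  The coefficient of t^q t'^q' z^j in e^(xi(t^(a),z) - xi(t'^(a),z)) is
  (-1)^deg q' / (q! q'!) if q, q' live on component a and j = wt q + wt q', else 0;
  the residue pairs it with the coefficient of z^(-j) of the two shifted factors.
\<close>
definition bil_side :: "'k::field_char_0 tser \<Rightarrow> comp \<Rightarrow> mono \<Rightarrow> mono \<Rightarrow> 'k" where
  "bil_side f a m m' =
     (\<Sum>(p, q)\<in>{(p, q). p + q = m}. \<Sum>(p', q')\<in>{(p', q'). p' + q' = m'}.
        (if on_comp a q \<and> on_comp a q' then
           (\<Sum>k\<in>{..wt q + wt q'}. shiftc (-2) a f k p * shiftc 2 a f (wt q + wt q' - k) p')
           * ((-1) ^ deg q' / of_nat (mfact q * mfact q'))
         else 0))"

definition is_2bkp_tau :: "'k::field_char_0 tser \<Rightarrow> bool" where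
  "is_2bkp_tau f \<longleftrightarrow> (\<forall>m m'. bil_side f Cmp1 m m' = bil_side f Cmp2 m m')"

text \<open>
  The parameters lambda, mu are formal.  Coefficient field
  K = complex fls fls = C((lambda^(-1)))((mu^(-1))): outer variable mu^(-1),
  inner variable lambda^(-1) (i.e. expansions valid for |mu| > |lambda|, large).
\<close>
type_synonym K = "complex fls fls"

definition mu :: K where "mu = fls_X_inv"
definition lam :: K where "lam = fls_const fls_X_inv"
definition cK :: "complex \<Rightarrow> K" where "cK c = fls_const (fls_const c)"

definition eps :: "comp \<Rightarrow> comp \<Rightarrow> K" where
  "eps a b = (if a = b then (mu + lam) / (mu - lam) else 1)"

text \<open>coefficient of t^q in e^(xi(t^(a),mu) - xi(t^(b),lambda))\<close>
definition Eml :: "comp \<Rightarrow> comp \<Rightarrow> mono \<Rightarrow> K" where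
  "Eml a b q = (\<Sum>(q1, q2)\<in>{(q1, q2). q1 + q2 = q}.
      if on_comp a q1 \<and> on_comp b q2
      then mu ^ wt q1 * (-1) ^ deg q2 * lam ^ wt q2 / of_nat (mfact q1 * mfact q2)
      else 0)"

text \<open>coefficient of t^p in f(t - 2[mu^(-1)]_a + 2[lambda^(-1)]_b)\<close>
definition Shml :: "comp \<Rightarrow> comp \<Rightarrow> complex tser \<Rightarrow> mono \<Rightarrow> K" where
  "Shml a b f p = fps_to_fls (Abs_fps (\<lambda>l. fps_to_fls (Abs_fps (\<lambda>k.
       shiftc (-2) a (shiftc 2 b f k) l p))))"

text \<open>X_ab(lambda,mu) f = eps_ab e^(xi(t^(a),mu)-xi(t^(b),lambda)) f(t - 2[mu^(-1)]_a + 2[lambda^(-1)]_b)\<close>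
definition Xop :: "comp \<Rightarrow> comp \<Rightarrow> complex tser \<Rightarrow> K tser" where
  "Xop a b f = (\<lambda>m. eps a b * (\<Sum>(p, q)\<in>{(p, q). p + q = m}. Eml a b q * Shml a b f p))"

end

theory Submission
  imports Defs "HOL-Library.Function_Algebras"
begin

text \<open>
  Expand \<open>X\<^sub>a(z) = \<Sum>\<^sub>n \<phi>\<^sub>n z\<^sup>n\<close>. The modes of one component satisfy the neutral fermion relations
  \<open>\<phi>\<^sub>i \<phi>\<^sub>j + \<phi>\<^sub>j \<phi>\<^sub>i = 2 (-1)\<^sup>i \<delta>\<close> with \<open>\<delta> = 1\<close> iff \<open>i + j = 0\<close>, modes of different components
  commute, and the two sides of the bilinear identity are
  \<open>\<Omega>\<^sub>c(f, g) = \<Sum>\<^sub>n (-1)\<^sup>n \<phi>\<^sub>n f \<otimes> \<phi>\<^sub>-\<^sub>n g\<close>. For \<open>\<tau> + C X \<tau>\<close> the part linear in \<open>C\<close> vanishes coefficientwise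
  in \<open>\<lambda>\<close>, \<open>\<mu>\<close>: moving \<open>\<phi>\<^sub>n\<close> through \<open>\<phi>\<^sub>i \<phi>\<^sub>j\<close> leaves terms that agree for both components.
  The quadratic part cannot be treated this way, because moving \<open>X\<^sub>a(z)\<close> through both factors
  produces divergent products of delta functions. Instead one uses that \<open>X\<^sub>a\<^sub>b\<close> is, up to the scalar
  \<open>\<epsilon>\<^sub>a\<^sub>b\<close>, a translation followed by multiplication with an exponential, and that
  \<open>\<Omega>\<^sub>c\<close> commutes with \<open>A \<otimes> 1 + 1 \<otimes> A\<close> for \<open>A\<close> a derivative in or the multiplication by
  a single time, hence with \<open>exp A \<otimes> exp A\<close>.
\<close>

subsection \<open>Monomials and weights\<close>

text \<open>Two devices carry the proof. Exponentials of infinitely many operators are never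
  multiplied out: each family of modes is pinned down by its logarithmic derivative, a recursion for
  k times the k-th mode, and in characteristic 0 commutation relations become inductions on k.
  Infinite mode sums become finite at each monomial because every mode is homogeneous for the
  weight; hence the truncation bounds that depend on the monomial and the recurring enlargement of
  summation windows. The two descriptions of X_ab, as a product of modes and as a scalar times
  translation and exponential, must give the same series. The pole of \<open>eps a a\<close> at mu =
  lambda makes this depend on the expansion: in \<open>K\<close> the powers of mu are bounded above,
  which matches the vanishing of high modes at a fixed monomial and singles out the mode product
  among all formal solutions of the relation with the factor mu - lambda.\<close>

lemma sum_fun_apply: "sum F A x = (\<Sum>i\<in>A. F i x)"
  by (induction A rule: infinite_finite_induct) auto

lemma wt_eq_sum:
  assumes "finite V" "Poly_Mapping.keys e \<subseteq> V"
  shows "wt e = (\<Sum>v\<in>V. Poly_Mapping.lookup e v * oddidx v)"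
  unfolding wt_def using assms
  by (intro sum.mono_neutral_left) (auto simp: in_keys_iff)

lemma mfact_eq_prod:
  assumes "finite V" "Poly_Mapping.keys e \<subseteq> V"
  shows "mfact e = (\<Prod>v\<in>V. fact (Poly_Mapping.lookup e v))"
  unfolding mfact_def using assms
  by (intro prod.mono_neutral_left) (auto simp: in_keys_iff)

lemma keys_add_nat: "Poly_Mapping.keys (p + q :: mono) = Poly_Mapping.keys p \<union> Poly_Mapping.keys q"
  by (auto simp: in_keys_iff lookup_add)

lemma wt_add [simp]: "wt (p + q) = wt p + wt q"
proof -
  let ?V = "Poly_Mapping.keys p \<union> Poly_Mapping.keys q"
  have "finite ?V" by simp
  then show ?thesis
    by (simp add: wt_eq_sum[of ?V] keys_add_nat lookup_add sum.distrib algebra_simps)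
qed

lemma wt_zero [simp]: "wt 0 = 0"
  by (simp add: wt_def)

lemma wt_single [simp]: "wt (Poly_Mapping.single v n) = n * oddidx v"
  by (simp add: wt_def)

lemma lookup_oddidx_le_wt: "Poly_Mapping.lookup e v * oddidx v \<le> wt e"
proof -
  have "wt e = (\<Sum>w\<in>insert v (Poly_Mapping.keys e). Poly_Mapping.lookup e w * oddidx w)"
    by (intro wt_eq_sum) auto
  then show ?thesis by (simp add: sum.insert_remove)
qed

lemma wt_eq_0_iff: "wt e = 0 \<longleftrightarrow> e = 0"
proof
  assume "wt e = 0"
  then have "Poly_Mapping.lookup e v = 0" for v
    using lookup_oddidx_le_wt[of e v] by (simp add: oddidx_def)
  then show "e = 0" by (intro poly_mapping_eqI) simp
qed simp

lemma on_comp_add [simp]: "on_comp a (p + q) \<longleftrightarrow> on_comp a p \<and> on_comp a q"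
  by (auto simp: on_comp_def keys_add_nat)

lemma on_comp_zero [simp]: "on_comp a 0"
  by (simp add: on_comp_def)

lemma on_comp_single [simp]: "on_comp a (Poly_Mapping.single (a, i) n)"
  by (simp add: on_comp_def)

lemma mfact_zero [simp]: "mfact 0 = 1"
  by (simp add: mfact_def)

lemma mfact_add_single:
  "mfact (e + Poly_Mapping.single v 1) = (Poly_Mapping.lookup e v + 1) * mfact e"
proof -
  let ?V = "insert v (Poly_Mapping.keys e)"
  have "mfact (e + Poly_Mapping.single v 1) =
      (\<Prod>w\<in>?V. fact (Poly_Mapping.lookup (e + Poly_Mapping.single v 1) w))"
    by (intro mfact_eq_prod) (auto simp: keys_add_nat)
  also have "\<dots> = (Poly_Mapping.lookup e v + 1) * (\<Prod>w\<in>?V. fact (Poly_Mapping.lookup e w))"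
  proof -
    have "(\<Prod>w\<in>?V - {v}. fact (Poly_Mapping.lookup (e + Poly_Mapping.single v 1) w)) =
        (\<Prod>w\<in>?V - {v}. fact (Poly_Mapping.lookup e w) :: nat)"
      by (intro prod.cong) (auto simp: lookup_add lookup_single when_def)
    then show ?thesis
      by (simp only: prod.remove[of ?V v] finite.insertI finite_keys insertI1)
         (simp add: lookup_add algebra_simps)
  qed
  also have "(\<Prod>w\<in>?V. fact (Poly_Mapping.lookup e w)) = mfact e"
    by (intro mfact_eq_prod[symmetric]) auto
  finally show ?thesis .
qed

text \<open>The weight bounds each exponent as well as each index that occurs, so infinitely many
  variables still leave finitely many monomials. Finiteness of the sums over monomials rests on
  this.\<close>

lemma finite_wt_le: "finite {e. wt e \<le> N}"
proof -
  let ?A = "{Cmp1, Cmp2} \<times> {..N}"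
  let ?F = "{f. \<forall>x. (x \<in> ?A \<longrightarrow> f x \<in> {..N}) \<and> (x \<notin> ?A \<longrightarrow> f x = (0::nat))}"
  have F: "finite ?F" by (rule finite_set_of_finite_funs) auto
  have "Poly_Mapping.lookup e \<in> ?F" if "wt e \<le> N" for e
  proof -
    have 1: "Poly_Mapping.lookup e v * (2 * snd v + 1) \<le> N" for v
      using lookup_oddidx_le_wt[of e v] that by (simp add: oddidx_def)
    have "Poly_Mapping.lookup e v \<le> N" for v using 1[of v] by (simp add: algebra_simps)
    moreover have "Poly_Mapping.lookup e v = 0" if "v \<notin> ?A" for v
    proof (rule ccontr)
      assume "Poly_Mapping.lookup e v \<noteq> 0"
      then have "2 * snd v + 1 \<le> Poly_Mapping.lookup e v * (2 * snd v + 1)"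
        by (cases "Poly_Mapping.lookup e v") auto
      with 1[of v] have "snd v \<le> N" by linarith
      moreover have "fst v \<in> {Cmp1, Cmp2}" by (cases "fst v") simp_all
      ultimately show False using that by (metis atMost_iff mem_Times_iff)
    qed
    ultimately show ?thesis by (intro CollectI allI conjI impI) (simp only: atMost_iff, metis)
  qed
  then have "Poly_Mapping.lookup ` {e. wt e \<le> N} \<subseteq> ?F"
    by (intro image_subsetI) (simp only: mem_Collect_eq)
  then have "finite (Poly_Mapping.lookup ` {e. wt e \<le> N})" using F by (rule finite_subset)
  then show ?thesis
    by (rule finite_imageD) (simp add: inj_on_def lookup_inject)
qed

text \<open>The weight is an integer so that recursions may step to \<open>k - odd_of i\<close>
  below zero, where the set is empty.\<close>

definition comp_monos :: "comp \<Rightarrow> int \<Rightarrow> mono set" where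
  "comp_monos a k = {e. on_comp a e \<and> int (wt e) = k}"

lemma finite_comp_monos [simp]: "finite (comp_monos a k)"
  by (rule finite_subset[OF _ finite_wt_le[of "nat k"]]) (auto simp: comp_monos_def)

lemma comp_monos_neg [simp]: "k < 0 \<Longrightarrow> comp_monos a k = {}"
  by (auto simp: comp_monos_def)

lemma comp_monos_0 [simp]: "comp_monos a 0 = {0}"
  by (auto simp: comp_monos_def wt_eq_0_iff)

lemma finite_splittings [simp]: "finite {(p, q). p + q = (m::mono)}"
proof (rule finite_subset)
  show "{(p, q). p + q = m} \<subseteq> {e. wt e \<le> wt m} \<times> {e. wt e \<le> wt m}" by auto
  show "finite ({e. wt e \<le> wt m} \<times> {e. wt e \<le> wt m})" using finite_wt_le by blast
qed

definition odd_of :: "nat \<Rightarrow> int" where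
  "odd_of i = 2 * int i + 1"

text \<open>The Euler operator: the weight of a monomial is distributed over its variables, one of which
  is then removed. This is the source of the recursions for both kinds of modes below.\<close>

lemma sum_comp_monos_Euler:
  fixes F :: "mono \<Rightarrow> 'k::field_char_0"
  assumes "k \<le> int N"
  shows "of_int k * sum F (comp_monos a k) =
    (\<Sum>i<N. of_int (odd_of i) * (\<Sum>e\<in>comp_monos a (k - odd_of i).
       of_nat (Poly_Mapping.lookup e (a, i) + 1) * F (e + Poly_Mapping.single (a, i) 1)))"
proof -
  have wt: "of_int k = (\<Sum>i<N. of_int (odd_of i) * (of_nat (Poly_Mapping.lookup e (a, i)) :: 'k))"
    if "e \<in> comp_monos a k" for e
  proof -
    \<comment> \<open>A variable of index i that occurs has weight 2i+1 at most k, hence i < N. The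
      cutoff is otherwise free, so one N can serve several recursions at once.\<close>
    have 1: "Poly_Mapping.keys e \<subseteq> Pair a ` {..<N}"
    proof
      fix v assume v: "v \<in> Poly_Mapping.keys e"
      then have "fst v = a" using that by (auto simp: comp_monos_def on_comp_def)
      moreover have "snd v < N"
      proof -
        have "oddidx v \<le> Poly_Mapping.lookup e v * oddidx v"
          using v by (cases "Poly_Mapping.lookup e v") (auto simp: in_keys_iff)
        with lookup_oddidx_le_wt[of e v] have "oddidx v \<le> wt e" by linarith
        then show ?thesis using that assms by (auto simp: comp_monos_def oddidx_def)
      qed
      ultimately show "v \<in> Pair a ` {..<N}" by (cases v) auto
    qed
    have "k = int (wt e)" using that by (simp add: comp_monos_def)
    also have "wt e = (\<Sum>v\<in>Pair a ` {..<N}. Poly_Mapping.lookup e v * oddidx v)"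
      by (rule wt_eq_sum) (use 1 in auto)
    also have "\<dots> = (\<Sum>i<N. Poly_Mapping.lookup e (a, i) * (2 * i + 1))"
      by (subst sum.reindex) (auto simp: inj_on_def oddidx_def)
    finally have "k = (\<Sum>i<N. odd_of i * int (Poly_Mapping.lookup e (a, i)))"
      by (simp add: odd_of_def algebra_simps)
    then have "(of_int k :: 'k) = of_int (\<Sum>i<N. odd_of i * int (Poly_Mapping.lookup e (a, i)))"
      by (rule arg_cong)
    then show ?thesis by simp
  qed
  have "of_int k * sum F (comp_monos a k) = (\<Sum>e\<in>comp_monos a k. \<Sum>i<N.
      of_int (odd_of i) * of_nat (Poly_Mapping.lookup e (a, i)) * F e)"
    by (simp add: sum_distrib_left wt sum_distrib_right)
  also have "\<dots> = (\<Sum>i<N. \<Sum>e\<in>comp_monos a k.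
      of_int (odd_of i) * of_nat (Poly_Mapping.lookup e (a, i)) * F e)"
    by (rule sum.swap)
  also have "\<dots> = (\<Sum>i<N. of_int (odd_of i) * (\<Sum>e\<in>comp_monos a (k - odd_of i).
       of_nat (Poly_Mapping.lookup e (a, i) + 1) * F (e + Poly_Mapping.single (a, i) 1)))"
  proof (rule sum.cong[OF refl])
    fix i
    let ?v = "Poly_Mapping.single (a, i) 1 :: mono"
    let ?g = "\<lambda>e. of_int (odd_of i) * of_nat (Poly_Mapping.lookup e (a, i)) * F e"
    have img: "(\<lambda>e. e + ?v) ` comp_monos a (k - odd_of i) =
        {e \<in> comp_monos a k. Poly_Mapping.lookup e (a, i) \<noteq> 0}" (is "?L = ?R")
    proof
      show "?L \<subseteq> ?R"
        by (auto simp: comp_monos_def oddidx_def odd_of_def lookup_add)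
      show "?R \<subseteq> ?L"
      proof
        fix e assume e: "e \<in> ?R"
        have "e = (e - ?v) + ?v"
          using e by (intro poly_mapping_eqI) (auto simp: lookup_add lookup_minus lookup_single when_def)
        moreover have "e - ?v \<in> comp_monos a (k - odd_of i)"
        proof -
          have "on_comp a ((e - ?v) + ?v)" "int (wt ((e - ?v) + ?v)) = k"
            using e calculation by (auto simp: comp_monos_def)
          then show ?thesis by (simp add: comp_monos_def oddidx_def odd_of_def)
        qed
        ultimately show "e \<in> ?L" by blast
      qed
    qed
    \<comment> \<open>Monomials without the variable carry a zero factor; the others are exactly the
      multiples of that variable.\<close>
    have "sum ?g (comp_monos a k) = sum ?g {e \<in> comp_monos a k. Poly_Mapping.lookup e (a, i) \<noteq> 0}"
      by (rule sum.mono_neutral_right) auto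
    also have "\<dots> = (\<Sum>e\<in>comp_monos a (k - odd_of i). ?g (e + ?v))"
      unfolding img[symmetric] by (subst sum.reindex) (auto simp: inj_on_def)
    finally show "sum ?g (comp_monos a k) = of_int (odd_of i) * (\<Sum>e\<in>comp_monos a (k - odd_of i).
       of_nat (Poly_Mapping.lookup e (a, i) + 1) * F (e + ?v))"
      by (simp add: sum_distrib_left lookup_add mult.assoc)
  qed
  finally show ?thesis .
qed

subsection \<open>Derivatives, multiplications and their exponentials\<close>

definition tderiv :: "tvar \<Rightarrow> 'k::field_char_0 tser \<Rightarrow> 'k tser" where
  "tderiv v f = (\<lambda>m. of_nat (Poly_Mapping.lookup m v + 1) * f (m + Poly_Mapping.single v 1))"

text \<open>Subtraction of exponents is truncated, hence the explicit zero when the variable is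
  absent.\<close>

definition tmult :: "tvar \<Rightarrow> 'k::field_char_0 tser \<Rightarrow> 'k tser" where
  "tmult v f = (\<lambda>m. if Poly_Mapping.lookup m v = 0 then 0 else f (m - Poly_Mapping.single v 1))"

text \<open>Extends \<open>shiftc\<close> by zero to negative indices, which removes boundary cases
  from the recursions.\<close>

definition shift_mode :: "'k::field_char_0 \<Rightarrow> comp \<Rightarrow> int \<Rightarrow> 'k tser \<Rightarrow> 'k tser" where
  "shift_mode s a k f = (if k < 0 then 0 else shiftc s a f (nat k))"

text \<open>The coefficient of z^k in e^(xi(t^(a), z)) f. The guard expresses divisibility of the
  monomial \<open>m\<close> by \<open>q\<close>.\<close>

definition exp_mode :: "comp \<Rightarrow> int \<Rightarrow> 'k::field_char_0 tser \<Rightarrow> 'k tser" where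
  "exp_mode a k f = (\<lambda>m. \<Sum>q\<in>comp_monos a k.
     if \<exists>p. p + q = m then f (m - q) / of_nat (mfact q) else 0)"

definition scl :: "'k \<Rightarrow> 'k::field_char_0 tser \<Rightarrow> 'k tser" where
  "scl c f = (\<lambda>m. c * f m)"

definition shift_weight :: "'k::field_char_0 \<Rightarrow> mono \<Rightarrow> mono \<Rightarrow> 'k" where
  "shift_weight s m e = (\<Prod>v\<in>Poly_Mapping.keys e.
     of_nat ((Poly_Mapping.lookup m v + Poly_Mapping.lookup e v) choose Poly_Mapping.lookup e v)
       * (s / of_nat (oddidx v)) ^ Poly_Mapping.lookup e v)"

lemma shift_mode_eq: "shift_mode s a k f m = (\<Sum>e\<in>comp_monos a k. f (m + e) * shift_weight s m e)"
  by (auto simp: shift_mode_def shiftc_def comp_monos_def shift_weight_def intro!: sum.cong)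

lemma shift_weight_eq:
  assumes "finite V" "Poly_Mapping.keys e \<subseteq> V"
  shows "shift_weight s m e = (\<Prod>v\<in>V.
     of_nat ((Poly_Mapping.lookup m v + Poly_Mapping.lookup e v) choose Poly_Mapping.lookup e v)
       * (s / of_nat (oddidx v)) ^ Poly_Mapping.lookup e v)"
  unfolding shift_weight_def using assms
  by (intro prod.mono_neutral_left) (auto simp: in_keys_iff)

text \<open>The identity (y+1) C(x+y+1, y+1) = (x+1) C(x+y+1, y), both sides being (x+y+1) C(x+y,
  y), turns one more power of the shifted variable into a derivative. The factor
  \<open>oddidx v\<close> cancels a denominator of [z^(-1)].\<close>

lemma shift_weight_add_single:
  fixes s :: "'k::field_char_0"
  shows "of_nat (Poly_Mapping.lookup e v + 1) * of_nat (oddidx v)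
      * shift_weight s m (e + Poly_Mapping.single v 1)
    = s * of_nat (Poly_Mapping.lookup m v + 1) * shift_weight s (m + Poly_Mapping.single v 1) e"
proof -
  let ?u = "Poly_Mapping.single v 1 :: mono"
  let ?V = "insert v (Poly_Mapping.keys e)"
  let ?g = "\<lambda>m e w. of_nat ((Poly_Mapping.lookup m w + Poly_Mapping.lookup e w) choose Poly_Mapping.lookup e w)
       * (s / of_nat (oddidx w)) ^ Poly_Mapping.lookup e w"
  define R where "R = prod (?g m e) (?V - {v})"
  have 1: "shift_weight s m (e + ?u) = ?g m (e + ?u) v * R"
    unfolding R_def
    by (subst shift_weight_eq[of ?V], simp, force simp: keys_add_nat, subst prod.remove[of _ v])
       (auto simp: lookup_add lookup_single when_def intro!: prod.cong)
  have 2: "shift_weight s (m + ?u) e = ?g (m + ?u) e v * R"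
    unfolding R_def
    by (subst shift_weight_eq[of ?V], simp, force, subst prod.remove[of _ v])
       (auto simp: lookup_add lookup_single when_def intro!: prod.cong)
  let ?x = "Poly_Mapping.lookup m v" and ?y = "Poly_Mapping.lookup e v"
  have "(?y + 1) * ((?x + (?y + 1)) choose (?y + 1)) = (?x + 1) * (((?x + 1) + ?y) choose ?y)"
  proof -
    have "(?y + 1) * ((?x + (?y + 1)) choose (?y + 1)) = Suc (?x + ?y) * ((?x + ?y) choose ?y)"
      using Suc_times_binomial[of ?y "?x + ?y"] by (simp only: add_Suc_right Suc_eq_plus1[symmetric])
    moreover have "(?x + 1) * (((?x + 1) + ?y) choose ?y) = Suc (?x + ?y) * ((?x + ?y) choose ?y)"
    proof -
      have "Suc (?x + ?y) - ?y = ?x + 1" "Suc (?x + ?y) - 1 = ?x + ?y" "?x + 1 + ?y = Suc (?x + ?y)"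
        by simp_all
      then show ?thesis using binomial_absorb_comp[of "Suc (?x + ?y)" ?y] by (simp only:)
    qed
    ultimately show ?thesis by (simp only:)
  qed
  then have "(of_nat ((?y + 1) * ((?x + (?y + 1)) choose (?y + 1))) :: 'k)
      = of_nat ((?x + 1) * (((?x + 1) + ?y) choose ?y))" by simp
  then have 3: "(of_nat (?y + 1) :: 'k) * of_nat ((?x + (?y + 1)) choose (?y + 1))
      = of_nat (?x + 1) * of_nat (((?x + 1) + ?y) choose ?y)" 
    unfolding of_nat_mult .
  have od: "(of_nat (oddidx v) :: 'k) \<noteq> 0" by (simp add: oddidx_def del: of_nat_Suc of_nat_add)
  have l: "Poly_Mapping.lookup (e + ?u) v = ?y + 1" "Poly_Mapping.lookup (m + ?u) v = ?x + 1"
    by (simp_all add: lookup_add)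
  have "of_nat (?y + 1) * of_nat (oddidx v) * shift_weight s m (e + ?u)
    = (of_nat (?y + 1) * of_nat ((?x + (?y + 1)) choose (?y + 1))) *
      (of_nat (oddidx v) * (s / of_nat (oddidx v)) ^ (?y + 1)) * R"
    unfolding 1 l by (simp only: mult_ac)
  also have "of_nat (oddidx v) * (s / of_nat (oddidx v)) ^ (?y + 1) = s * (s / of_nat (oddidx v)) ^ ?y"
    using od by simp
  finally show ?thesis unfolding 2 3 l by (simp only: mult_ac)
qed

text \<open>The coefficient of z^(-k) in -z d/dz of exp(s sum_n z^(-n) d_n / n) f; differentiation
  cancels each 1/n.\<close>

lemma shift_mode_Euler:
  assumes "k \<le> int N"
  shows "scl (of_int k) (shift_mode s a k f) =
    (\<Sum>i<N. scl s (tderiv (a, i) (shift_mode s a (k - odd_of i) f)))"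
proof
  fix m
  have "scl (of_int k) (shift_mode s a k f) m =
     (\<Sum>i<N. of_int (odd_of i) * (\<Sum>e\<in>comp_monos a (k - odd_of i).
       of_nat (Poly_Mapping.lookup e (a, i) + 1) *
       (f (m + (e + Poly_Mapping.single (a, i) 1)) * shift_weight s m (e + Poly_Mapping.single (a, i) 1))))"
    unfolding scl_def shift_mode_eq by (rule sum_comp_monos_Euler[OF assms])
  also have "\<dots> = (\<Sum>i<N. scl s (tderiv (a, i) (shift_mode s a (k - odd_of i) f)) m)"
  proof (rule sum.cong[OF refl])
    fix i
    let ?u = "Poly_Mapping.single (a, i) 1 :: mono"
    have od: "(of_int (odd_of i) :: 'a) = of_nat (oddidx (a, i))"
      by (simp add: odd_of_def oddidx_def)
    have "of_int (odd_of i) * (of_nat (Poly_Mapping.lookup e (a, i) + 1) *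
       (f (m + (e + ?u)) * shift_weight s m (e + ?u))) =
       s * (of_nat (Poly_Mapping.lookup m (a, i) + 1) * (f (m + ?u + e) * shift_weight s (m + ?u) e))" for e
    proof -
      have eq: "m + (e + ?u) = m + ?u + e" by (simp add: add_ac)
      show ?thesis unfolding od eq
        using arg_cong[OF shift_weight_add_single[of e "(a, i)" s m], of "\<lambda>x. f (m + ?u + e) * x"]
        by (simp only: mult_ac)
    qed
    then show "of_int (odd_of i) * (\<Sum>e\<in>comp_monos a (k - odd_of i).
       of_nat (Poly_Mapping.lookup e (a, i) + 1) *
       (f (m + (e + ?u)) * shift_weight s m (e + ?u))) =
       scl s (tderiv (a, i) (shift_mode s a (k - odd_of i) f)) m"
      unfolding scl_def tderiv_def shift_mode_eq sum_distrib_left by (simp only:)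
  qed
  finally show "scl (of_int k) (shift_mode s a k f) m =
    (\<Sum>i<N. scl s (tderiv (a, i) (shift_mode s a (k - odd_of i) f))) m"
    by (simp add: sum_fun_apply)
qed

text \<open>The coefficient of z^k in z d/dz e^(xi(t^(a), z)) f = (sum_n n t_n z^n) e^(xi(t^(a), z))
  f.\<close>

lemma exp_mode_Euler:
  fixes f :: "'k::field_char_0 tser"
  assumes "k \<le> int N"
  shows "scl (of_int k) (exp_mode a k f) =
    (\<Sum>i<N. scl (of_int (odd_of i)) (tmult (a, i) (exp_mode a (k - odd_of i) f)))"
proof
  fix m
  let ?u = "\<lambda>i. Poly_Mapping.single (a, i) 1 :: mono"
  let ?F = "\<lambda>m q. if \<exists>p. p + q = m then f (m - q) / of_nat (mfact q) else 0"
  have "scl (of_int k) (exp_mode a k f) m =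
     (\<Sum>i<N. of_int (odd_of i) * (\<Sum>e\<in>comp_monos a (k - odd_of i).
       of_nat (Poly_Mapping.lookup e (a, i) + 1) * ?F m (e + ?u i)))"
    unfolding scl_def exp_mode_def by (rule sum_comp_monos_Euler[OF assms])
  also have "\<dots> = (\<Sum>i<N. scl (of_int (odd_of i)) (tmult (a, i) (exp_mode a (k - odd_of i) f)) m)"
  proof (rule sum.cong[OF refl])
    fix i
    have "of_nat (Poly_Mapping.lookup e (a, i) + 1) * ?F m (e + ?u i) =
      (if Poly_Mapping.lookup m (a, i) = 0 then 0 else ?F (m - ?u i) e)" for e
    proof (cases "\<exists>p. p + (e + ?u i) = m")
      case True
      then obtain p where p: "m = p + (e + ?u i)" by blast
      then have 1: "Poly_Mapping.lookup m (a, i) \<noteq> 0" by (simp add: lookup_add)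
      have 2: "m - ?u i = p + e" unfolding p by (simp flip: add.assoc)
      have "(of_nat (Poly_Mapping.lookup e (a, i) + 1) :: 'k) \<noteq> 0" by (simp del: of_nat_Suc of_nat_add)
      then have "of_nat (Poly_Mapping.lookup e (a, i) + 1) * ?F m (e + ?u i) = f p / of_nat (mfact e)"
        using True unfolding mfact_add_single of_nat_mult by (simp add: p)
      moreover have "?F (m - ?u i) e = f p / of_nat (mfact e)"
        unfolding 2 by auto
      ultimately show ?thesis using 1 by simp
    next
      case False
      have "\<not> (\<exists>p. p + e = m - ?u i)" if "Poly_Mapping.lookup m (a, i) \<noteq> 0"
      proof
        assume "\<exists>p. p + e = m - ?u i"
        then obtain p where p: "p + e = m - ?u i" by blast
        have "m - ?u i + ?u i = m"
          using that by (intro poly_mapping_eqI) (auto simp: lookup_add lookup_minus lookup_single when_def)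
        then have "p + (e + ?u i) = m" using p by (simp flip: add.assoc)
        with False show False by blast
      qed
      then show ?thesis using False by auto
    qed
    then show "of_int (odd_of i) * (\<Sum>e\<in>comp_monos a (k - odd_of i).
       of_nat (Poly_Mapping.lookup e (a, i) + 1) * ?F m (e + ?u i)) =
       scl (of_int (odd_of i)) (tmult (a, i) (exp_mode a (k - odd_of i) f)) m"
      unfolding scl_def tmult_def exp_mode_def by simp
  qed
  finally show "scl (of_int k) (exp_mode a k f) m =
    (\<Sum>i<N. scl (of_int (odd_of i)) (tmult (a, i) (exp_mode a (k - odd_of i) f))) m"
    by (simp add: sum_fun_apply)
qed

section \<open>Linear operators and the canonical commutation relations\<close>

lemma scl_apply: "scl c f m = c * f m"
  by (simp add: scl_def)

declare plus_fun_apply [simp del] zero_fun_apply [simp del] minus_apply [simp del]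

lemmas pointwise = fun_eq_iff plus_fun_apply zero_fun_apply minus_apply scl_apply sum_fun_apply

lemma scl_cancel:
  assumes "scl c f = scl c g" "c \<noteq> 0"
  shows "f = g"
  using assms by (auto simp: pointwise)

lemma scl_zero [simp]: "scl 0 f = 0" "scl c 0 = 0"
  by (auto simp: pointwise)

lemma scl_one [simp]: "scl 1 f = f"
  by (auto simp: pointwise)

lemma scl_add_right: "scl c (f + g) = scl c f + scl c g"
  by (auto simp: pointwise algebra_simps)

lemma scl_add_left: "scl (c + d) f = scl c f + scl d f"
  by (auto simp: pointwise algebra_simps)

lemma scl_scl [simp]: "scl c (scl d f) = scl (c * d) f"
  by (auto simp: pointwise algebra_simps)

lemma scl_sum_right: "scl c (sum f A) = (\<Sum>x\<in>A. scl c (f x))"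
  by (auto simp: pointwise sum_fun_apply sum_distrib_left)

definition tlinear :: "('k::field_char_0 tser \<Rightarrow> 'k tser) \<Rightarrow> bool" where
  "tlinear A \<longleftrightarrow> (\<forall>f g. A (f + g) = A f + A g) \<and> (\<forall>c f. A (scl c f) = scl c (A f))"

lemma tlinearD:
  assumes "tlinear A"
  shows "A (f + g) = A f + A g" "A (scl c f) = scl c (A f)" "A 0 = 0"
    "A (f - g) = A f - A g" "A (sum h I) = (\<Sum>i\<in>I. A (h i))"
proof -
  show add: "A (f + g) = A f + A g" for f g using assms by (simp add: tlinear_def)
  show scl: "A (scl c f) = scl c (A f)" for c f using assms by (simp add: tlinear_def)
  show zero: "A 0 = 0" using scl[of 0 0] by simp
  show "A (f - g) = A f - A g" using add[of "f - g" g] by simp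
  show "A (sum h I) = (\<Sum>i\<in>I. A (h i))"
  proof (induction I rule: infinite_finite_induct)
    case (insert i I)
    then show ?case by (simp only: sum.insert[OF insert.hyps] add insert.IH)
  qed (simp_all only: sum.infinite sum.empty zero not_False_eq_True)
qed

lemma tlinear_comp: "tlinear A \<Longrightarrow> tlinear B \<Longrightarrow> tlinear (\<lambda>f. A (B f))"
  by (simp add: tlinear_def)

lemma tlinear_scl: "tlinear (scl c)"
  by (auto simp: tlinear_def pointwise algebra_simps)

lemma tlinear_tderiv: "tlinear (tderiv v)"
  by (auto simp: tlinear_def tderiv_def pointwise algebra_simps)

lemma tlinear_tmult: "tlinear (tmult v)"
  by (auto simp: tlinear_def tmult_def pointwise algebra_simps)

lemma tlinear_shift_mode: "tlinear (shift_mode s a k)"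
  by (auto simp: tlinear_def shift_mode_eq pointwise algebra_simps sum.distrib sum_distrib_left)

lemma tlinear_exp_mode: "tlinear (exp_mode a k)"
proof -
  have "exp_mode a k (f + g) m = exp_mode a k f m + exp_mode a k g m" for f g :: "'k::field_char_0 tser" and m
    unfolding exp_mode_def plus_fun_apply sum.distrib[symmetric]
    by (intro sum.cong) (auto simp: add_divide_distrib)
  moreover have "exp_mode a k (scl c f) m = c * exp_mode a k f m" for f :: "'k::field_char_0 tser" and m c
    unfolding exp_mode_def scl_apply sum_distrib_left
    by (intro sum.cong) auto
  ultimately show ?thesis by (auto simp: tlinear_def pointwise)
qed

lemma odd_of_pos: "odd_of i > 0"
  by (simp add: odd_of_def)

lemma tderiv_commute: "tderiv v (tderiv w f) = tderiv w (tderiv v f)"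
  by (cases "v = w") (auto simp: tderiv_def pointwise lookup_add lookup_single when_def add_ac)

lemma tmult_commute: "tmult v (tmult w f) = tmult w (tmult v f)"
  by (cases "v = w")
     (auto simp: tmult_def pointwise lookup_minus lookup_single when_def diff_diff_add add.commute)

text \<open>The Heisenberg relation; the scalar corrections in all exchange relations between modes
  originate here.\<close>

lemma tderiv_tmult: "tderiv v (tmult w f) = tmult w (tderiv v f) + (if v = w then f else 0)"
proof
  fix m
  let ?u = "\<lambda>v. Poly_Mapping.single v 1 :: mono"
  show "tderiv v (tmult w f) m = (tmult w (tderiv v f) + (if v = w then f else 0)) m"
  proof (cases "Poly_Mapping.lookup m w = 0")
    case True
    then show ?thesis
      by (auto simp: tderiv_def tmult_def pointwise lookup_add lookup_single when_def)
  next
    case False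
    have m: "m - ?u w + ?u w = m"
      using False by (intro poly_mapping_eqI) (auto simp: lookup_add lookup_minus lookup_single when_def)
    have "m + ?u v - ?u w = m - ?u w + ?u w + ?u v - ?u w" by (simp only: m)
    also have "\<dots> = m - ?u w + ?u v + ?u w - ?u w" by (simp only: add_ac)
    also have "\<dots> = m - ?u w + ?u v" by (rule add_diff_cancel_right')
    finally have eq: "m + ?u v - ?u w = m - ?u w + ?u v" .
    have l: "Poly_Mapping.lookup (m - ?u w) v = Poly_Mapping.lookup m v - (if v = w then 1 else 0)"
      by (auto simp: lookup_minus lookup_single when_def)
    have lw: "Poly_Mapping.lookup (m + ?u v) w \<noteq> 0" using False by (simp add: lookup_add)
    have "tderiv v (tmult w f) m = of_nat (Poly_Mapping.lookup m v + 1) * f (m - ?u w + ?u v)"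
      unfolding tderiv_def tmult_def using lw by (simp only: eq if_False)
    moreover have "tmult w (tderiv v f) m
        = of_nat (Poly_Mapping.lookup (m - ?u w) v + 1) * f (m - ?u w + ?u v)"
      unfolding tderiv_def tmult_def using False by simp
    moreover have "of_nat (Poly_Mapping.lookup m v + 1) * f (m - ?u w + ?u v)
        = of_nat (Poly_Mapping.lookup (m - ?u w) v + 1) * f (m - ?u w + ?u v)
          + (if v = w then f else 0) m"
      unfolding l using False by (cases "v = w") (simp_all only: m if_True if_False diff_zero
        zero_fun_apply add_0_right, simp add: algebra_simps of_nat_diff)
    ultimately show ?thesis by (simp only: plus_fun_apply)
  qed
qed

lemma tmult_tderiv: "tmult w (tderiv v f) = tderiv v (tmult w f) - (if v = w then f else 0)"
  by (simp add: tderiv_tmult)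

text \<open>Modes \<open>U\<^sub>k\<close> of \<open>exp (\<Sum>\<^sub>i A\<^sub>i z\<^bsup>2i+1\<^esup> / (2i+1))\<close> for commuting operators \<open>A\<^sub>i\<close>,
  characterised by the logarithmic derivative in \<open>z\<close>.\<close>

definition exp_modes :: "(nat \<Rightarrow> 'k::field_char_0 tser \<Rightarrow> 'k tser) \<Rightarrow> (int \<Rightarrow> 'k tser \<Rightarrow> 'k tser) \<Rightarrow> bool" where
  "exp_modes A U \<longleftrightarrow> (\<forall>i. tlinear (A i)) \<and> (\<forall>k. tlinear (U k)) \<and>
     (\<forall>k f. k < 0 \<longrightarrow> U k f = 0) \<and> (\<forall>f. U 0 f = f) \<and>
     (\<forall>k N f. k \<le> int N \<longrightarrow> scl (of_int k) (U k f) = (\<Sum>i<N. A i (U (k - odd_of i) f)))"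

lemma exp_modesD:
  assumes "exp_modes A U"
  shows "tlinear (A i)" "tlinear (U k)" "k < 0 \<Longrightarrow> U k f = 0" "U 0 f = f"
    "k \<le> int N \<Longrightarrow> scl (of_int k) (U k f) = (\<Sum>i<N. A i (U (k - odd_of i) f))"
  using assms unfolding exp_modes_def by blast+

lemma int_measure_induct [case_names nonpos pos]:
  fixes P :: "int \<Rightarrow> bool"
  assumes "\<And>k. k \<le> 0 \<Longrightarrow> P k"
    and "\<And>k. k > 0 \<Longrightarrow> (\<And>j. j < k \<Longrightarrow> P j) \<Longrightarrow> P k"
  shows "P k"
proof (induction "nat k" arbitrary: k rule: less_induct)
  case less
  show ?case
  proof (cases "k \<le> 0")
    case False
    then have "P j" if "j < k" for j using less[of j] that by auto
    then show ?thesis using assms(2) False by auto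
  qed (use assms(1) in auto)
qed

lemma exp_modes_shift: "exp_modes (\<lambda>i f. scl s (tderiv (a, i) f)) (shift_mode s a)"
  unfolding exp_modes_def
proof (intro conjI allI impI)
  show "shift_mode s a 0 f = f" for f
    by (auto simp: pointwise shift_mode_eq shift_weight_def)
  show "k < 0 \<Longrightarrow> shift_mode s a k f = 0" for k f
    by (simp only: shift_mode_def if_True)
qed (auto simp only: shift_mode_Euler tlinear_shift_mode
      intro: tlinear_comp[OF tlinear_scl tlinear_tderiv])

lemma exp_modes_exp: "exp_modes (\<lambda>i f. scl (of_int (odd_of i)) (tmult (a, i) f)) (exp_mode a)"
  unfolding exp_modes_def
proof (intro conjI allI impI)
  show "exp_mode a 0 f = f" for f
    by (auto simp: pointwise exp_mode_def)
  show "k < 0 \<Longrightarrow> exp_mode a k f = 0" for k f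
    by (simp add: exp_mode_def pointwise)
qed (auto simp only: exp_mode_Euler tlinear_exp_mode
      intro: tlinear_comp[OF tlinear_scl tlinear_tmult])

text \<open>With n = \<open>odd_of i0\<close>, the commutator of the exponent with \<open>B\<close>
  is the scalar c z^n, so conjugation by the exponential turns \<open>B\<close> into B + c
  z^n.\<close>

lemma exp_modes_commute:
  assumes U: "exp_modes A U" and B: "tlinear B"
    and AB: "\<And>i f. A i (B f) = B (A i f) + (if i = i0 then scl (c * of_int (odd_of i0)) f else 0)"
  shows "U k (B f) = B (U k f) + scl c (U (k - odd_of i0) f)"
proof (induction k rule: int_measure_induct)
  case (nonpos k)
  then show ?case using odd_of_pos[of i0]
    by (cases "k = 0") (simp_all add: exp_modesD[OF U] tlinearD[OF B])
next
  case (pos k)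
  \<comment> \<open>The cutoff lies above \<open>i0\<close>, so the one exceptional summand is
    present.\<close>
  define N where "N = Suc (nat k + i0)"
  have N: "k \<le> int N" "k - odd_of i0 \<le> int N" "i0 < N"
    using pos odd_of_pos[of i0] by (auto simp: N_def)
  note U' = exp_modesD(5)[OF U]
  have IH: "U (k - odd_of i) (B f) = B (U (k - odd_of i) f) + scl c (U (k - odd_of i - odd_of i0) f)" for i
    by (rule pos.IH) (use odd_of_pos[of i] in auto)
  have "scl (of_int k) (U k (B f)) = (\<Sum>i<N. A i (U (k - odd_of i) (B f)))"
    by (rule U') fact
  also have "\<dots> = (\<Sum>i<N. B (A i (U (k - odd_of i) f))
      + (if i = i0 then scl (c * of_int (odd_of i0)) (U (k - odd_of i) f) else 0)
      + scl c (A i (U (k - odd_of i0 - odd_of i) f)))"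
    by (intro sum.cong refl) (simp add: IH AB tlinearD[OF exp_modesD(1)[OF U]] algebra_simps)
  also have "\<dots> = B (\<Sum>i<N. A i (U (k - odd_of i) f))
      + scl (c * of_int (odd_of i0)) (U (k - odd_of i0) f)
      + scl c (\<Sum>i<N. A i (U (k - odd_of i0 - odd_of i) f))"
    using N(3) by (simp add: sum.distrib tlinearD(5)[OF B] scl_sum_right)
  also have "(\<Sum>i<N. A i (U (k - odd_of i) f)) = scl (of_int k) (U k f)"
    by (rule U'[symmetric]) fact
  also have "(\<Sum>i<N. A i (U (k - odd_of i0 - odd_of i) f))
      = scl (of_int (k - odd_of i0)) (U (k - odd_of i0) f)"
    by (rule U'[symmetric]) fact
  \<comment> \<open>The two contributions n and k - n to the correction term add up to k.\<close>
  also have "B (scl (of_int k) (U k f)) + scl (c * of_int (odd_of i0)) (U (k - odd_of i0) f)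
      + scl c (scl (of_int (k - odd_of i0)) (U (k - odd_of i0) f))
      = scl (of_int k) (B (U k f) + scl c (U (k - odd_of i0) f))"
    by (simp add: tlinearD[OF B] pointwise algebra_simps)
  finally show ?case using pos by (elim scl_cancel) auto
qed

lemma exp_modes_commute':
  assumes U: "exp_modes A U" and B: "tlinear B" and AB: "\<And>i f. A i (B f) = B (A i f)"
  shows "U k (B f) = B (U k f)"
  using exp_modes_commute[OF U B, of 0 0] AB by simp

section \<open>Commutation relations of translation and exponential modes\<close>

lemma shift_mode_tderiv: "shift_mode s a k (tderiv v f) = tderiv v (shift_mode s a k f)"
  by (rule exp_modes_commute'[OF exp_modes_shift tlinear_tderiv])
     (metis tderiv_commute tlinearD(2) tlinear_tderiv)

text \<open>Translation replaces t_n by t_n + s z^(-n)/n on its own component.\<close>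

lemma shift_mode_tmult:
  "shift_mode s a k (tmult (b, i) f) = tmult (b, i) (shift_mode s a k f)
     + scl (if a = b then s / of_int (odd_of i) else 0) (shift_mode s a (k - odd_of i) f)"
  by (rule exp_modes_commute[OF exp_modes_shift tlinear_tmult])
     (use odd_of_pos[of i] in \<open>auto simp: tderiv_tmult scl_add_right tlinearD[OF tlinear_tmult]\<close>)

lemma exp_mode_tmult: "exp_mode a k (tmult v f) = tmult v (exp_mode a k f)"
  by (rule exp_modes_commute'[OF exp_modes_exp tlinear_tmult])
     (metis tmult_commute tlinearD(2) tlinear_tmult)

text \<open>Conjugation by e^(xi(t^(a), z)) replaces d_n by d_n - z^n.\<close>

lemma exp_mode_tderiv:
  "exp_mode a k (tderiv (b, i) f) = tderiv (b, i) (exp_mode a k f)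
     - (if a = b then exp_mode a (k - odd_of i) f else 0)"
proof -
  have "exp_mode a k (tderiv (b, i) f) = tderiv (b, i) (exp_mode a k f)
     + scl (if a = b then - 1 else 0) (exp_mode a (k - odd_of i) f)"
    by (rule exp_modes_commute[OF exp_modes_exp tlinear_tderiv])
       (auto simp: tmult_tderiv tlinearD[OF tlinear_tderiv] pointwise algebra_simps)
  then show ?thesis by (auto simp: pointwise)
qed

lemma shift_mode_commute:
  "shift_mode s a k (shift_mode s' b l f) = shift_mode s' b l (shift_mode s a k f)"
  by (rule exp_modes_commute'[OF exp_modes_shift tlinear_shift_mode])
     (simp add: shift_mode_tderiv tlinearD[OF tlinear_shift_mode])

lemma exp_mode_commute: "exp_mode a k (exp_mode b l f) = exp_mode b l (exp_mode a k f)"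
  by (rule exp_modes_commute'[OF exp_modes_exp tlinear_exp_mode])
     (simp add: exp_mode_tmult tlinearD[OF tlinear_exp_mode])

lemma shift_mode_exp_mode_diff:
  assumes "a \<noteq> b"
  shows "shift_mode s a k (exp_mode b l f) = exp_mode b l (shift_mode s a k f)"
  by (rule exp_modes_commute'[OF exp_modes_shift tlinear_exp_mode])
     (use assms in \<open>auto simp: exp_mode_tderiv tlinearD[OF tlinear_exp_mode]\<close>)

text \<open>Only odd powers occur in [z^(-1)], so reversing the translation amounts to replacing z
  by -z.\<close>

lemma shift_mode_uminus: "shift_mode (- s) a k f = scl ((-1) ^ nat k) (shift_mode s a k f)"
proof (induction k rule: int_measure_induct)
  case (nonpos k)
  then show ?case
    by (cases "k = 0") (simp_all add: exp_modesD(3,4)[OF exp_modes_shift])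
next
  case (pos k)
  define N where "N = nat k"
  have N: "k \<le> int N" using pos by (simp add: N_def)
  have "scl (of_int k) (shift_mode (- s) a k f) =
      (\<Sum>i<N. scl (- s) (tderiv (a, i) (shift_mode (- s) a (k - odd_of i) f)))"
    by (rule shift_mode_Euler[OF N])
  also have "\<dots> = (\<Sum>i<N. scl ((-1) ^ nat k) (scl s (tderiv (a, i) (shift_mode s a (k - odd_of i) f))))"
  proof (rule sum.cong[OF refl])
    fix i
    have IH: "shift_mode (- s) a (k - odd_of i) f
        = scl ((-1) ^ nat (k - odd_of i)) (shift_mode s a (k - odd_of i) f)"
      by (rule pos.IH) (use odd_of_pos[of i] in auto)
    show "scl (- s) (tderiv (a, i) (shift_mode (- s) a (k - odd_of i) f))
        = scl ((-1) ^ nat k) (scl s (tderiv (a, i) (shift_mode s a (k - odd_of i) f)))"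
    proof (cases "k < odd_of i")
      case True
      then show ?thesis
        by (simp add: exp_modesD(3)[OF exp_modes_shift] tlinearD[OF tlinear_tderiv])
    next
      case False
      then have "nat k = nat (k - odd_of i) + (2 * i + 1)"
        using pos by (auto simp: odd_of_def)
      then have "(-1 :: 'a) ^ nat k = - ((-1) ^ nat (k - odd_of i))"
        by (simp add: power_add)
      then show ?thesis
        by (simp add: IH tlinearD[OF tlinear_tderiv] pointwise)
    qed
  qed
  also have "\<dots> = scl ((-1) ^ nat k) (scl (of_int k) (shift_mode s a k f))"
    unfolding scl_sum_right[symmetric] shift_mode_Euler[OF N, of s a f] ..
  finally have "scl (of_int k) (shift_mode (- s) a k f)
      = scl (of_int k) (scl ((-1) ^ nat k) (shift_mode s a k f))"
    by (simp add: mult.commute)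
  then show ?case using pos by (elim scl_cancel) auto
qed

text \<open>Homogeneity for the weight: a coefficient of the result sees a single weight of the
  input. This allows an infinite mode sum to be truncated underneath a further operator.\<close>

lemma shift_mode_local:
  assumes "\<And>p. int (wt p) = int (wt m) + k \<Longrightarrow> f p = g p"
  shows "shift_mode s a k f m = shift_mode s a k g m"
  unfolding shift_mode_eq
  by (intro sum.cong refl) (use assms in \<open>auto simp: comp_monos_def\<close>)

lemma exp_mode_local:
  assumes "\<And>p. int (wt p) = int (wt m) - k \<Longrightarrow> f p = g p"
  shows "exp_mode a k f m = exp_mode a k g m"
  unfolding exp_mode_def
proof (intro sum.cong refl if_cong)
  fix q assume "q \<in> comp_monos a k" "\<exists>p. p + q = m"
  then have "f (m - q) = g (m - q)" by (intro assms) (auto simp: comp_monos_def)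
  then show "f (m - q) / of_nat (mfact q) = g (m - q) / of_nat (mfact q)" by simp
qed

lemma exp_mode_eq_0: "k > int (wt m) \<Longrightarrow> exp_mode a k f m = 0"
  unfolding exp_mode_def by (intro sum.neutral) (auto simp: comp_monos_def)

lemma shift_mode_neg: "k < 0 \<Longrightarrow> shift_mode s a k f = 0"
  by (rule exp_modesD(3)[OF exp_modes_shift])

lemma exp_mode_neg: "k < 0 \<Longrightarrow> exp_mode a k f = 0"
  by (rule exp_modesD(3)[OF exp_modes_exp])

lemma shift_mode_0 [simp]: "shift_mode s a 0 f = f"
  by (rule exp_modesD(4)[OF exp_modes_shift])

lemma exp_mode_0 [simp]: "exp_mode a 0 f = f"
  by (rule exp_modesD(4)[OF exp_modes_exp])

lemma sum_int_shift: "(\<Sum>l\<in>{K..L::int}. F (l - c)) = (\<Sum>l\<in>{K - c..L - c}. F l)"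
  by (rule sum.reindex_bij_witness[of _ "\<lambda>l. l + c" "\<lambda>l. l - c"]) auto

text \<open>Opposite translations are inverse to each other. Their logarithmic derivatives cancel,
  which kills every coefficient of positive degree.\<close>

lemma sum_shift_modes_inverse:
  "(\<Sum>l\<in>{0..D}. shift_mode s a l (shift_mode (- s) a (D - l) f)) = (if D = 0 then f else 0)"
proof (cases "D \<le> 0")
  case True
  then show ?thesis by (cases "D = 0") auto
next
  case False
  define N where "N = nat D"
  have N: "D \<le> int N" by (simp add: N_def)
  let ?S = "shift_mode s a" and ?T = "shift_mode (- s) a"
  \<comment> \<open>The terms gained or lost at the ends contain a mode of negative index.\<close>
  have reidx: "(\<Sum>l\<in>{0..D}. ?S (l - odd_of i) (?T (D - l) f)) = (\<Sum>l\<in>{0..D}. ?S l (?T (D - l - odd_of i) f))"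
    for i
  proof -
    have "(\<Sum>l\<in>{0..D}. ?S (l - odd_of i) (?T (D - l) f))
        = (\<Sum>l\<in>{0 - odd_of i..D - odd_of i}. ?S l (?T (D - l - odd_of i) f))"
      unfolding sum_int_shift[symmetric] by (simp add: algebra_simps)
    also have "\<dots> = (\<Sum>l\<in>{0..D}. ?S l (?T (D - l - odd_of i) f))"
      by (rule sum.mono_neutral_cong)
         (use odd_of_pos[of i] in \<open>auto simp: shift_mode_neg tlinearD[OF tlinear_shift_mode]\<close>)
    finally show ?thesis .
  qed
  have "scl (of_int D) (\<Sum>l\<in>{0..D}. ?S l (?T (D - l) f))
      = (\<Sum>l\<in>{0..D}. scl (of_int l) (?S l (?T (D - l) f)) + ?S l (scl (of_int (D - l)) (?T (D - l) f)))"
    unfolding scl_sum_right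
    by (intro sum.cong refl) (simp add: tlinearD[OF tlinear_shift_mode] scl_add_left[symmetric])
  also have "\<dots> = (\<Sum>l\<in>{0..D}. \<Sum>i<N. scl s (tderiv (a, i) (?S (l - odd_of i) (?T (D - l) f)))
      - scl s (tderiv (a, i) (?S l (?T (D - l - odd_of i) f))))"
  proof (rule sum.cong[OF refl])
    fix l assume "l \<in> {0..D}"
    then have l: "l \<le> int N" "D - l \<le> int N" using N by auto
    show "scl (of_int l) (?S l (?T (D - l) f)) + ?S l (scl (of_int (D - l)) (?T (D - l) f)) =
      (\<Sum>i<N. scl s (tderiv (a, i) (?S (l - odd_of i) (?T (D - l) f)))
      - scl s (tderiv (a, i) (?S l (?T (D - l - odd_of i) f))))"
      unfolding shift_mode_Euler[OF l(1)] shift_mode_Euler[OF l(2)]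
      by (simp add: tlinearD[OF tlinear_shift_mode] shift_mode_tderiv sum_subtractf)
         (simp add: pointwise sum_negf)
  qed
  also have "\<dots> = (\<Sum>i<N. scl s (tderiv (a, i) (\<Sum>l\<in>{0..D}. ?S (l - odd_of i) (?T (D - l) f)))
      - scl s (tderiv (a, i) (\<Sum>l\<in>{0..D}. ?S l (?T (D - l - odd_of i) f))))"
    by (subst sum.swap) (simp add: sum_subtractf scl_sum_right tlinearD[OF tlinear_tderiv])
  also have "\<dots> = 0" by (simp add: reidx)
  finally have "scl (of_int D) (\<Sum>l\<in>{0..D}. ?S l (?T (D - l) f)) = scl (of_int D) 0" by simp
  then have "(\<Sum>l\<in>{0..D}. ?S l (?T (D - l) f)) = 0" by (rule scl_cancel) (use False in auto)
  then show ?thesis using False by simp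
qed

text \<open>The expansion coefficients of \<open>(1 - x) / (1 + x)\<close>.\<close>

definition reflect_coeff :: "int \<Rightarrow> 'k::field_char_0" where
  "reflect_coeff x = (if x < 0 then 0 else if x = 0 then 1 else if even x then 2 else - 2)"

text \<open>For r(x) = (1-x)/(1+x) the logarithm is -2 (x + x^3/3 + ...), so x r'(x) = -2 (x + x^3 +
  ...) r(x). Removing the first summand leaves the sum for y - 2, hence the induction by steps of
  two.\<close>

lemma sum_reflect_coeff:
  assumes "y \<le> N"
  shows "(\<Sum>i<N. - 2 * reflect_coeff (int y - odd_of i)) = (of_nat y * reflect_coeff (int y) :: 'k::field_char_0)"
  using assms
proof (induction y arbitrary: N rule: less_induct)
  case (less y)
  consider "y = 0" | "y = 1" | z where "y = z + 2"
    by (metis One_nat_def add_2_eq_Suc' not0_implies_Suc)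
  then show ?case
  proof cases
    case 1
    then show ?thesis by (simp add: reflect_coeff_def odd_of_def)
  next
    case 2
    then obtain N' where N': "N = Suc N'" using less.prems by (cases N) auto
    show ?thesis
      unfolding N' sum.lessThan_Suc_shift using 2 by (simp add: reflect_coeff_def odd_of_def)
  next
    case 3
    then obtain N' where N': "N = Suc N'" "z \<le> N'" using less.prems by (cases N) auto
    have "odd_of (Suc i) = odd_of i + 2" for i by (simp add: odd_of_def)
    then have "(\<Sum>i<N. - 2 * reflect_coeff (int y - odd_of i))
        = - 2 * reflect_coeff (int y - 1) + (\<Sum>i<N'. - 2 * (reflect_coeff (int z - odd_of i) :: 'k))"
      unfolding N' sum.lessThan_Suc_shift using 3 by (simp add: odd_of_def algebra_simps)
    also have "(\<Sum>i<N'. - 2 * (reflect_coeff (int z - odd_of i) :: 'k)) = of_nat z * reflect_coeff (int z)"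
      using 3 N' by (intro less.IH) auto
    also have "- 2 * reflect_coeff (int y - 1) + of_nat z * (reflect_coeff (int z) :: 'k)
        = of_nat y * reflect_coeff (int y)"
      using 3 by (auto simp: reflect_coeff_def algebra_simps)
    finally show ?thesis .
  qed
qed

lemma sum_nat_shift_support:
  fixes h :: "int \<Rightarrow> 'b::comm_monoid_add"
  assumes "\<And>x y. x < 0 \<Longrightarrow> g x y = 0" "\<And>x y. y \<ge> int M \<Longrightarrow> g x y = 0" "c \<ge> 0"
  shows "(\<Sum>x<M. g (int x) (int x + c)) = (\<Sum>y<M. g (int y - c) (int y))"
proof -
  have "(\<Sum>x<M. g (int x) (int x + c)) = (\<Sum>x\<in>{0..<int M}. g x (x + c))"
    by (rule sum.reindex_bij_witness[of _ nat int]) auto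
  also have "\<dots> = (\<Sum>x\<in>{0..<int M - c}. g x (x + c))"
    by (rule sum.mono_neutral_right) (use assms in auto)
  also have "\<dots> = (\<Sum>y\<in>{c..<int M}. g (y - c) y)"
    by (rule sum.reindex_bij_witness[of _ "\<lambda>y. y - c" "\<lambda>x. x + c"]) auto
  also have "\<dots> = (\<Sum>y\<in>{0..<int M}. g (y - c) y)"
    by (rule sum.mono_neutral_left) (use assms in auto)
  also have "\<dots> = (\<Sum>y<M. g (int y - c) (int y))"
    by (rule sum.reindex_bij_witness[of _ int nat]) auto
  finally show ?thesis .
qed

text \<open>Translating by -2[z^(-1)] adds -2 sum_n x^n/n = log((1-x)/(1+x)), with x = w/z, to
  xi(t^(a), w). This scalar factor arises when the translation moves to the right of the
  exponential. Any \<open>M\<close> beyond \<open>l\<close> will do because modes of negative index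
  vanish.\<close>

lemma shift_mode_exp_mode:
  assumes "l < int M"
  shows "shift_mode (- 2) a l (exp_mode a j f) =
    (\<Sum>x<M. scl (reflect_coeff (int x)) (exp_mode a (j - int x) (shift_mode (- 2) a (l - int x) f)))"
  using assms
proof (induction l rule: int_measure_induct)
  case (nonpos l)
  show ?case
  proof (cases "l = 0")
    case True
    then obtain M' where M': "M = Suc M'" using nonpos by (cases M) auto
    show ?thesis unfolding M' sum.lessThan_Suc_shift using True
      by (simp add: shift_mode_neg tlinearD[OF tlinear_exp_mode] reflect_coeff_def)
  next
    case False
    then show ?thesis using nonpos by (simp add: shift_mode_neg tlinearD[OF tlinear_exp_mode])
  qed
next
  case (pos l)
  define N where "N = nat l + M"
  have N: "l \<le> int N" by (simp add: N_def)
  let ?T = "shift_mode (- 2) a" and ?E = "exp_mode a" and ?r = "\<lambda>x. reflect_coeff (int x)"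
  define h where "h y = ?E (j - y) (?T (l - y) f)" for y
  have h0: "h y = 0" if "y \<ge> int M" for y
    using that pos.prems by (simp add: h_def shift_mode_neg tlinearD[OF tlinear_exp_mode])
  have IH: "?T (l - odd_of i) (?E j f) = (\<Sum>x<M. scl (?r x) (?E (j - int x) (?T (l - odd_of i - int x) f)))" for i
    by (rule pos.IH) (use odd_of_pos[of i] pos.prems in auto)
  have "scl (of_int l) (?T l (?E j f)) = (\<Sum>i<N. scl (- 2) (tderiv (a, i) (?T (l - odd_of i) (?E j f))))"
    by (rule shift_mode_Euler[OF N])
  also have "\<dots> = (\<Sum>i<N. \<Sum>x<M. scl (?r x) (?E (j - int x) (scl (- 2) (tderiv (a, i) (?T (l - int x - odd_of i) f))))
      + scl (- 2 * ?r x) (h (int x + odd_of i)))"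
  proof (rule sum.cong[OF refl])
    fix i
    have eq: "tderiv (a, i) (?E (j - int x) (?T (l - odd_of i - int x) f)) =
      ?E (j - int x) (tderiv (a, i) (?T (l - int x - odd_of i) f)) + h (int x + odd_of i)" for x
      by (simp add: exp_mode_tderiv h_def algebra_simps)
    show "scl (- 2) (tderiv (a, i) (?T (l - odd_of i) (?E j f))) =
      (\<Sum>x<M. scl (?r x) (?E (j - int x) (scl (- 2) (tderiv (a, i) (?T (l - int x - odd_of i) f))))
      + scl (- 2 * ?r x) (h (int x + odd_of i)))"
      unfolding IH
      by (simp add: tlinearD[OF tlinear_tderiv] tlinearD[OF tlinear_exp_mode] eq scl_sum_right
          scl_add_right mult.commute)
  qed
  also have "\<dots> = (\<Sum>x<M. scl (?r x) (?E (j - int x) (\<Sum>i<N. scl (- 2) (tderiv (a, i) (?T (l - int x - odd_of i) f)))))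
      + (\<Sum>i<N. \<Sum>x<M. scl (- 2 * ?r x) (h (int x + odd_of i)))"
    unfolding sum.distrib
    by (subst sum.swap) (simp add: tlinearD[OF tlinear_exp_mode] scl_sum_right)
  \<comment> \<open>Collected by total index y, the commutator terms give y r(y) by
    \<open>sum_reflect_coeff\<close>; the recursion for the translation gives (l - y) r(y), and the
    two add up to l r(y).\<close>
  also have "(\<Sum>i<N. \<Sum>x<M. scl (- 2 * ?r x) (h (int x + odd_of i)))
      = (\<Sum>i<N. \<Sum>y<M. scl (- 2 * reflect_coeff (int y - odd_of i)) (h (int y)))"
    by (intro sum.cong refl sum_nat_shift_support[where g="\<lambda>x y. scl (- 2 * reflect_coeff x) (h y)"])
       (use odd_of_pos in \<open>auto simp: h0 reflect_coeff_def intro: less_imp_le\<close>)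
  also have "\<dots> = (\<Sum>y<M. scl (\<Sum>i<N. - 2 * reflect_coeff (int y - odd_of i)) (h (int y)))"
    by (subst sum.swap) (simp add: pointwise sum_distrib_right)
  also have "\<dots> = (\<Sum>y<M. scl (of_nat y * ?r y) (h (int y)))"
    by (intro sum.cong refl arg_cong2[where f=scl] sum_reflect_coeff) (auto simp: N_def)
  also have "(\<Sum>x<M. scl (?r x) (?E (j - int x) (\<Sum>i<N. scl (- 2) (tderiv (a, i) (?T (l - int x - odd_of i) f)))))
     = (\<Sum>x<M. scl (?r x * of_int (l - int x)) (h (int x)))"
  proof (intro sum.cong refl)
    fix x
    have Nx: "l - int x \<le> int N" using N by simp
    show "scl (?r x) (?E (j - int x) (\<Sum>i<N. scl (- 2) (tderiv (a, i) (?T (l - int x - odd_of i) f))))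
      = scl (?r x * of_int (l - int x)) (h (int x))"
      unfolding shift_mode_Euler[OF Nx, symmetric] by (simp add: tlinearD[OF tlinear_exp_mode] h_def)
  qed
  also have "\<dots> + (\<Sum>y<M. scl (of_nat y * ?r y) (h (int y))) = scl (of_int l) (\<Sum>x<M. scl (?r x) (h (int x)))"
    by (simp add: pointwise sum_distrib_left algebra_simps flip: sum.distrib)
  finally have "?T l (?E j f) = (\<Sum>x<M. scl (?r x) (h (int x)))"
    by (rule scl_cancel) (use pos in auto)
  then show ?case by (simp only: h_def)
qed

text \<open>Multiplication by 1 + x clears the denominator of (1-x)/(1+x) and leaves two terms on
  each side.\<close>

lemma shift_mode_exp_mode_Suc:
  "shift_mode (- 2) a l (exp_mode a j f) + shift_mode (- 2) a (l - 1) (exp_mode a (j - 1) f) =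
   exp_mode a j (shift_mode (- 2) a l f) - exp_mode a (j - 1) (shift_mode (- 2) a (l - 1) f)"
proof -
  define M where "M = Suc (nat l)"
  define h where "h y = exp_mode a (j - y) (shift_mode (- 2) a (l - y) f)" for y
  have M: "l < int (Suc M)" "l - 1 < int M" by (auto simp: M_def)
  have 1: "shift_mode (- 2) a l (exp_mode a j f) = (\<Sum>x<Suc M. scl (reflect_coeff (int x)) (h (int x)))"
    unfolding h_def by (rule shift_mode_exp_mode[OF M(1)])
  have 2: "shift_mode (- 2) a (l - 1) (exp_mode a (j - 1) f)
      = (\<Sum>x<M. scl (reflect_coeff (int x)) (h (int (Suc x))))"
    unfolding shift_mode_exp_mode[OF M(2)] h_def by (simp add: algebra_simps)
  have 3: "(\<Sum>x<M. scl (reflect_coeff (int (Suc x))) (h (int (Suc x))))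
     + (\<Sum>x<M. scl (reflect_coeff (int x)) (h (int (Suc x)))) = - h 1"
  proof -
    have r: "reflect_coeff (int (Suc (Suc x))) + reflect_coeff (int (Suc x)) = (0 :: 'a)"
      "reflect_coeff (int (Suc 0)) + reflect_coeff (int 0) = (- 1 :: 'a)" for x
      by (simp_all add: reflect_coeff_def)
    show ?thesis
      unfolding sum.distrib[symmetric] scl_add_left[symmetric]
      unfolding M_def sum.lessThan_Suc_shift r
      by (simp add: pointwise)
  qed
  have "shift_mode (- 2) a l (exp_mode a j f) + shift_mode (- 2) a (l - 1) (exp_mode a (j - 1) f)
    = h 0 + - h 1"
    unfolding 1 2 sum.lessThan_Suc_shift 3[symmetric] by (simp add: reflect_coeff_def add.assoc)
  then show ?thesis by (simp add: h_def)
qed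

subsection \<open>Modes of the vertex operators\<close>

text \<open>The coefficient of z^n in X_a(z) f. The sum over l has no bound of its own, but the
  exponential mode of index n + l vanishes at \<open>m\<close> once n + l exceeds the
  weight.\<close>

definition vertex_mode :: "comp \<Rightarrow> int \<Rightarrow> 'k::field_char_0 tser \<Rightarrow> 'k tser" where
  "vertex_mode a n f = (\<lambda>m. \<Sum>l\<in>{0..int (wt m) - n}. exp_mode a (n + l) (shift_mode (- 2) a l f) m)"

text \<open>Free bounds let several coefficients be computed over one common window, possibly a
  shifted one.\<close>

lemma vertex_mode_eq:
  assumes "K \<le> 0" "L \<ge> int (wt m) - n"
  shows "vertex_mode a n f m = (\<Sum>l\<in>{K..L}. exp_mode a (n + l) (shift_mode (- 2) a l f)) m"
  unfolding vertex_mode_def sum_fun_apply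
  by (rule sum.mono_neutral_left)
     (use assms in \<open>auto simp: shift_mode_neg exp_mode_eq_0 tlinearD[OF tlinear_exp_mode] zero_fun_apply\<close>)

lemma tlinear_vertex_mode: "tlinear (vertex_mode a n)"
  unfolding tlinear_def
  by (auto simp: fun_eq_iff vertex_mode_def tlinearD[OF tlinear_exp_mode] tlinearD[OF tlinear_shift_mode]
      plus_fun_apply scl_apply sum.distrib sum_distrib_left)

lemma vertex_mode_local:
  assumes "\<And>p. int (wt p) = int (wt m) - n \<Longrightarrow> f p = g p"
  shows "vertex_mode a n f m = vertex_mode a n g m"
  unfolding vertex_mode_def
  by (intro sum.cong refl exp_mode_local shift_mode_local assms) auto

lemma vertex_mode_eq_0: "n > int (wt m) \<Longrightarrow> vertex_mode a n f m = 0"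
  by (simp add: vertex_mode_def)

lemma vertex_mode_at_0: "vertex_mode a n f 0 = shift_mode (- 2) a (- n) f 0"
proof (cases "n > 0")
  case True
  then show ?thesis by (simp add: vertex_mode_eq_0 shift_mode_neg zero_fun_apply)
next
  case False
  have "vertex_mode a n f 0 = (\<Sum>l\<in>{- n}. exp_mode a (n + l) (shift_mode (- 2) a l f) 0)"
    unfolding vertex_mode_def
    by (rule sum.mono_neutral_right) (use False in \<open>auto simp: exp_mode_neg zero_fun_apply\<close>)
  then show ?thesis by simp
qed

lemma tderiv_local: "f (m + Poly_Mapping.single v 1) = g (m + Poly_Mapping.single v 1) \<Longrightarrow> tderiv v f m = tderiv v g m"
  by (simp add: tderiv_def)

lemma tmult_local: "f (m - Poly_Mapping.single v 1) = g (m - Poly_Mapping.single v 1) \<Longrightarrow> tmult v f m = tmult v g m"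
  by (simp add: tmult_def)

text \<open>In generating form [d_n, X_a(z)] = z^n X_a(z): the translation commutes with d_n and the
  exponential produces z^n.\<close>

lemma tderiv_vertex_mode:
  "tderiv (b, i) (vertex_mode a n f) = vertex_mode a n (tderiv (b, i) f)
     + (if a = b then vertex_mode a (n - odd_of i) f else 0)"
proof
  fix m
  let ?T = "shift_mode (- 2) a" and ?E = "exp_mode a"
  define L where "L = int (wt m) + odd_of i + \<bar>n\<bar>"
  note L = L_def odd_of_pos[of i]
  have "tderiv (b, i) (vertex_mode a n f) m = tderiv (b, i) (\<Sum>l\<in>{0..L}. ?E (n + l) (?T l f)) m"
    by (intro tderiv_local vertex_mode_eq) (use L in \<open>auto simp: oddidx_def odd_of_def\<close>)
  also have "\<dots> = (\<Sum>l\<in>{0..L}. ?E (n + l) (?T l (tderiv (b, i) f))) m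
      + (if a = b then \<Sum>l\<in>{0..L}. ?E (n - odd_of i + l) (?T l f) else 0) m"
    by (simp add: tlinearD[OF tlinear_tderiv] shift_mode_tderiv exp_mode_tderiv sum_subtractf
        plus_fun_apply minus_apply zero_fun_apply algebra_simps)
  also have "(\<Sum>l\<in>{0..L}. ?E (n + l) (?T l (tderiv (b, i) f))) m = vertex_mode a n (tderiv (b, i) f) m"
    by (intro vertex_mode_eq[symmetric]) (use L in auto)
  also have "(\<Sum>l\<in>{0..L}. ?E (n - odd_of i + l) (?T l f)) m = vertex_mode a (n - odd_of i) f m"
    by (intro vertex_mode_eq[symmetric]) (use L in auto)
  then have "(if a = b then \<Sum>l\<in>{0..L}. ?E (n - odd_of i + l) (?T l f) else 0) m
      = (if a = b then vertex_mode a (n - odd_of i) f else 0) m" by (cases "a = b") simp_all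
  finally show "tderiv (b, i) (vertex_mode a n f) m = (vertex_mode a n (tderiv (b, i) f)
     + (if a = b then vertex_mode a (n - odd_of i) f else 0)) m"
    by (simp add: plus_fun_apply)
qed

text \<open>In generating form [t_n, X_a(z)] = (2/n) z^(-n) X_a(z), now produced by the translation
  by -2[z^(-1)].\<close>

lemma tmult_vertex_mode:
  "tmult (b, i) (vertex_mode a n f) = vertex_mode a n (tmult (b, i) f)
     + (if a = b then scl (2 / of_int (odd_of i)) (vertex_mode a (n + odd_of i) f) else 0)"
proof
  fix m
  let ?T = "shift_mode (- 2) a" and ?E = "exp_mode a"
  let ?c = "2 / of_int (odd_of i)"
  define L where "L = int (wt m) + odd_of i + \<bar>n\<bar>"
  note L = L_def odd_of_pos[of i]
  have wt: "wt (m - Poly_Mapping.single (b, i) 1) \<le> wt m"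
  proof (cases "Poly_Mapping.lookup m (b, i) = 0")
    case True
    then have "m - Poly_Mapping.single (b, i) 1 = m"
      by (intro poly_mapping_eqI) (auto simp: lookup_minus lookup_single when_def)
    then show ?thesis by simp
  next
    case False
    then have "m = m - Poly_Mapping.single (b, i) 1 + Poly_Mapping.single (b, i) 1"
      by (intro poly_mapping_eqI) (auto simp: lookup_add lookup_minus lookup_single when_def)
    then have "wt m = wt (m - Poly_Mapping.single (b, i) 1 + Poly_Mapping.single (b, i) 1)" by (rule arg_cong)
    then show ?thesis by simp
  qed
  have "tmult (b, i) (vertex_mode a n f) m = tmult (b, i) (\<Sum>l\<in>{0..L}. ?E (n + l) (?T l f)) m"
    by (intro tmult_local vertex_mode_eq) (use L wt in auto)
  also have "\<dots> = (\<Sum>l\<in>{0..L}. ?E (n + l) (?T l (tmult (b, i) f))) m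
      + (if a = b then scl ?c (\<Sum>l\<in>{0..L}. ?E (n + odd_of i + (l - odd_of i)) (?T (l - odd_of i) f)) else 0) m"
    by (auto simp: tlinearD[OF tlinear_tmult] tlinearD[OF tlinear_exp_mode] shift_mode_tmult exp_mode_tmult
        pointwise algebra_simps sum.distrib sum_distrib_left sum_negf simp flip: sum_divide_distrib)
  also have "(\<Sum>l\<in>{0..L}. ?E (n + l) (?T l (tmult (b, i) f))) m = vertex_mode a n (tmult (b, i) f) m"
    by (intro vertex_mode_eq[symmetric]) (use L in auto)
  also have "(\<Sum>l\<in>{0..L}. ?E (n + odd_of i + (l - odd_of i)) (?T (l - odd_of i) f)) m = vertex_mode a (n + odd_of i) f m"
    unfolding sum_int_shift[where F="\<lambda>l. ?E (n + odd_of i + l) (?T l f)"]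
    by (intro vertex_mode_eq[symmetric]) (use L in auto)
  then have "(if a = b then scl ?c (\<Sum>l\<in>{0..L}. ?E (n + odd_of i + (l - odd_of i)) (?T (l - odd_of i) f)) else 0) m
      = (if a = b then scl ?c (vertex_mode a (n + odd_of i) f) else 0) m" by (cases "a = b") (simp_all add: scl_apply)
  finally show "tmult (b, i) (vertex_mode a n f) m = (vertex_mode a n (tmult (b, i) f)
     + (if a = b then scl ?c (vertex_mode a (n + odd_of i) f) else 0)) m"
    by (simp only: plus_fun_apply)
qed

section \<open>Normally ordered products :X_a(mu) X_b(nu): and their modes\<close>

definition normal_mode :: "comp \<Rightarrow> comp \<Rightarrow> int \<Rightarrow> int \<Rightarrow> 'k::field_char_0 tser \<Rightarrow> 'k tser" where
  "normal_mode a b i j f = (\<lambda>m. \<Sum>l\<in>{0..int (wt m) - i}. \<Sum>k\<in>{0..int (wt m) - j}.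
     exp_mode a (i + l) (exp_mode b (j + k) (shift_mode (- 2) a l (shift_mode (- 2) b k f))) m)"

lemma exp_mode_exp_mode_eq_0:
  fixes f :: "'a::field_char_0 tser"
  assumes "i > int (wt m) \<or> j > int (wt m)"
  shows "exp_mode a i (exp_mode b j f) m = 0"
proof -
  have *: "exp_mode a i (exp_mode b j f) m = 0" if "i > int (wt m)" for a b i j and f :: "'a tser"
    using that by (rule exp_mode_eq_0)
  show ?thesis using assms *[of i a b j f] *[of j b a i f] by (auto simp: exp_mode_commute[of a i b j])
qed

lemma normal_mode_eq:
  assumes "K \<le> 0" "L \<ge> int (wt m) - i" "K' \<le> 0" "L' \<ge> int (wt m) - j"
  shows "normal_mode a b i j f m = (\<Sum>l\<in>{K..L}. \<Sum>k\<in>{K'..L'}.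
     exp_mode a (i + l) (exp_mode b (j + k) (shift_mode (- 2) a l (shift_mode (- 2) b k f)))) m"
proof -
  have 0: "exp_mode a (i + l) (exp_mode b (j + k) (shift_mode (- 2) a l (shift_mode (- 2) b k f))) m = 0"
    if "l < 0 \<or> k < 0 \<or> l > int (wt m) - i \<or> k > int (wt m) - j" for l k
  proof (cases "l < 0 \<or> k < 0")
    case True
    then have "shift_mode (- 2) a l (shift_mode (- 2) b k f) = 0"
      by (auto simp: shift_mode_neg tlinearD[OF tlinear_shift_mode])
    then show ?thesis by (simp add: tlinearD[OF tlinear_exp_mode] zero_fun_apply)
  next
    case False
    then show ?thesis using that by (intro exp_mode_exp_mode_eq_0) auto
  qed
  show ?thesis
    unfolding normal_mode_def sum_fun_apply unfolding sum.cartesian_product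
  proof (rule sum.mono_neutral_left)
    show "{0..int (wt m) - i} \<times> {0..int (wt m) - j} \<subseteq> {K..L} \<times> {K'..L'}" using assms by auto
    show "finite ({K..L} \<times> {K'..L'})" by simp
  next
    show "\<forall>x\<in>{K..L} \<times> {K'..L'} - {0..int (wt m) - i} \<times> {0..int (wt m) - j}. (case x of (l, k) \<Rightarrow>
        exp_mode a (i + l) (exp_mode b (j + k) (shift_mode (- 2) a l (shift_mode (- 2) b k f))) m) = 0"
    proof
      fix x assume "x \<in> {K..L} \<times> {K'..L'} - {0..int (wt m) - i} \<times> {0..int (wt m) - j}"
      then show "(case x of (l, k) \<Rightarrow>
        exp_mode a (i + l) (exp_mode b (j + k) (shift_mode (- 2) a l (shift_mode (- 2) b k f))) m) = 0"
        by (cases x) (simp only: prod.case, rule 0, auto)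
    qed
  qed
qed

lemma normal_mode_commute: "normal_mode a b i j f = normal_mode b a j i f"
proof
  fix m
  show "normal_mode a b i j f m = normal_mode b a j i f m"
    unfolding normal_mode_def
    by (subst sum.swap)
       (simp only: exp_mode_commute[of a _ b] shift_mode_commute[of _ a _ _ b])
qed

lemma vertex_mode_vertex_mode_eq:
  assumes "K \<le> 0" "L \<ge> int (wt m) - i" "K' \<le> 0" "L' \<ge> int (wt m) - i - j"
  shows "vertex_mode a i (vertex_mode b j f) m = (\<Sum>l\<in>{K..L}. \<Sum>k\<in>{K'..L'}.
     exp_mode a (i + l) (shift_mode (- 2) a l (exp_mode b (j + k) (shift_mode (- 2) b k f)))) m"
proof -
  have "vertex_mode a i (vertex_mode b j f) m = vertex_mode a i
      (\<Sum>k\<in>{K'..L'}. exp_mode b (j + k) (shift_mode (- 2) b k f)) m"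
    by (intro vertex_mode_local vertex_mode_eq) (use assms in auto)
  also have "\<dots> = (\<Sum>l\<in>{K..L}. exp_mode a (i + l) (shift_mode (- 2) a l
      (\<Sum>k\<in>{K'..L'}. exp_mode b (j + k) (shift_mode (- 2) b k f)))) m"
    by (intro vertex_mode_eq) (use assms in auto)
  finally show ?thesis
    by (simp add: tlinearD[OF tlinear_exp_mode] tlinearD[OF tlinear_shift_mode])
qed

text \<open>Translations and exponentials on different components commute, so the product is already
  normally ordered.\<close>

lemma vertex_mode_vertex_mode_diff:
  assumes "a \<noteq> b"
  shows "vertex_mode a i (vertex_mode b j f) = normal_mode a b i j f"
proof
  fix m
  define L where "L = int (wt m) + \<bar>i\<bar> + \<bar>j\<bar>"
  have "vertex_mode a i (vertex_mode b j f) m = (\<Sum>l\<in>{0..L}. \<Sum>k\<in>{0..L}.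
     exp_mode a (i + l) (shift_mode (- 2) a l (exp_mode b (j + k) (shift_mode (- 2) b k f)))) m"
    by (rule vertex_mode_vertex_mode_eq) (auto simp: L_def)
  also have "\<dots> = normal_mode a b i j f m"
    unfolding shift_mode_exp_mode_diff[OF assms]
    by (rule normal_mode_eq[symmetric]) (auto simp: L_def)
  finally show "vertex_mode a i (vertex_mode b j f) m = normal_mode a b i j f m" .
qed

lemma vertex_mode_commute_diff:
  "a \<noteq> b \<Longrightarrow> vertex_mode a i (vertex_mode b j f) = vertex_mode b j (vertex_mode a i f)"
  by (simp add: vertex_mode_vertex_mode_diff normal_mode_commute[of a])

text \<open>The operator form of \<open>(\<mu> + \<nu>) X(\<mu>) X(\<nu>) = (\<mu> - \<nu>) :X(\<mu>) X(\<nu>):\<close>.\<close>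

lemma vertex_mode_normal_mode:
  "vertex_mode a (i - 1) (vertex_mode a j f) + vertex_mode a i (vertex_mode a (j - 1) f) =
   normal_mode a a (i - 1) j f - normal_mode a a i (j - 1) f"
proof
  fix m
  let ?T = "shift_mode (- 2) a" and ?E = "exp_mode a"
  define L where "L = int (wt m) + \<bar>i\<bar> + \<bar>j\<bar> + 2"
  let ?S = "\<lambda>G. (\<Sum>l\<in>{0..L}. \<Sum>k\<in>{0..L}. G l k) m"
  have 1: "vertex_mode a (i - 1) (vertex_mode a j f) m = ?S (\<lambda>l k. ?E (i - 1 + l) (?T l (?E (j + k) (?T k f))))"
    by (rule vertex_mode_vertex_mode_eq) (auto simp: L_def)
  \<comment> \<open>The window for l starts at -1 here; after l is replaced by l - 1 all four sums
    share one window and the exchange relation applies term by term.\<close>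
  have "vertex_mode a i (vertex_mode a (j - 1) f) m = (\<Sum>l\<in>{0 - 1..L - 1}. \<Sum>k\<in>{0..L}.
      ?E (i + l) (?T l (?E (j - 1 + k) (?T k f)))) m"
    by (rule vertex_mode_vertex_mode_eq) (auto simp: L_def)
  then have 2: "vertex_mode a i (vertex_mode a (j - 1) f) m =
      ?S (\<lambda>l k. ?E (i + (l - 1)) (?T (l - 1) (?E (j - 1 + k) (?T k f))))"
    unfolding sum_int_shift[symmetric] .
  have 3: "normal_mode a a (i - 1) j f m = ?S (\<lambda>l k. ?E (i - 1 + l) (?E (j + k) (?T l (?T k f))))"
    by (rule normal_mode_eq) (auto simp: L_def)
  have "normal_mode a a i (j - 1) f m = (\<Sum>l\<in>{0 - 1..L - 1}. \<Sum>k\<in>{0..L}.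
      ?E (i + l) (?E (j - 1 + k) (?T l (?T k f)))) m"
    by (rule normal_mode_eq) (auto simp: L_def)
  then have 4: "normal_mode a a i (j - 1) f m =
      ?S (\<lambda>l k. ?E (i + (l - 1)) (?E (j - 1 + k) (?T (l - 1) (?T k f))))"
    unfolding sum_int_shift[symmetric] .
  have "?E (i - 1 + l) (?T l (?E (j + k) (?T k f))) + ?E (i + (l - 1)) (?T (l - 1) (?E (j - 1 + k) (?T k f)))
      = ?E (i - 1 + l) (?E (j + k) (?T l (?T k f))) - ?E (i + (l - 1)) (?E (j - 1 + k) (?T (l - 1) (?T k f)))"
    for l k
    using arg_cong[OF shift_mode_exp_mode_Suc[of a l "j + k" "?T k f"], of "?E (i - 1 + l)"]
    by (simp add: tlinearD[OF tlinear_exp_mode] algebra_simps)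
  note key = this
  have S: "?S G + ?S H = ?S (\<lambda>l k. G l k + H l k)" "?S G - ?S H = ?S (\<lambda>l k. G l k - H l k)"
    for G H :: "int \<Rightarrow> int \<Rightarrow> 'a tser"
    by (simp_all add: sum_fun_apply sum.distrib sum_subtractf plus_fun_apply minus_apply)
  show "(vertex_mode a (i - 1) (vertex_mode a j f) + vertex_mode a i (vertex_mode a (j - 1) f)) m =
    (normal_mode a a (i - 1) j f - normal_mode a a i (j - 1) f) m"
    unfolding plus_fun_apply[of _ _ m] minus_apply[of _ _ m] 1 2 3 4 S by (simp only: key)
qed

section \<open>The neutral fermion relations\<close>

definition sg :: "int \<Rightarrow> 'k::field_char_0" where
  "sg i = (if even i then 1 else - 1)"

lemma sg_simps [simp]: "sg 0 = 1" "sg (- i) = sg i" "sg (i + odd_of n) = - sg i" "sg (i - odd_of n) = - sg i"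
  "sg i * sg i = 1" "sg i * (sg i * x) = x"
  by (auto simp: sg_def odd_of_def)

lemma sg_add: "sg (i + j) = sg i * sg j"
  by (auto simp: sg_def)

text \<open>This is the value at the origin of phi_(-L) phi_1 f, whose outer factor reduces there to
  a translation. Only the term with trivial exponential survives; its coefficient -2 (-1)^l turns a
  translation by -2 into one by 2, and what remains is a product of opposite translations. The index
  1 keeps \<open>reflect_coeff\<close> away from its exceptional value at 0.\<close>

lemma shift_mode_vertex_mode_1_at_0:
  "shift_mode (- 2) a L (vertex_mode a 1 f) 0 = (if L = 1 then - 2 * f 0 else 0)"
proof (cases "L \<ge> 1")
  case False
  then have "shift_mode (- 2) a L (vertex_mode a 1 f) 0 = 0"
    by (cases "L = 0") (auto simp: shift_mode_neg vertex_mode_eq_0 zero_fun_apply)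
  then show ?thesis using False by simp
next
  case True
  let ?T = "shift_mode (- 2) a" and ?E = "exp_mode a"
  define M where "M = nat L + 2"
  have "?T L (vertex_mode a 1 f) 0 = ?T L (\<Sum>l\<in>{0..L - 1}. ?E (1 + l) (?T l f)) 0"
    by (intro shift_mode_local vertex_mode_eq) auto
  also have "\<dots> = (\<Sum>l\<in>{0..L - 1}. ?T L (?E (1 + l) (?T l f)) 0)"
    by (simp add: tlinearD[OF tlinear_shift_mode] sum_fun_apply)
  also have "\<dots> = (\<Sum>l\<in>{0..L - 1}. - 2 * shift_mode 2 a l (?T (L - 1 - l) f) 0)"
  proof (rule sum.cong[OF refl])
    fix l assume l: "l \<in> {0..L - 1}"
    have "?T L (?E (1 + l) (?T l f)) 0 =
      (\<Sum>x<M. scl (reflect_coeff (int x)) (?E (1 + l - int x) (?T (L - int x) (?T l f)))) 0"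
      by (subst shift_mode_exp_mode[of L M]) (auto simp: M_def)
    also have "\<dots> = (\<Sum>x\<in>{nat (1 + l)}. reflect_coeff (int x) * ?E (1 + l - int x) (?T (L - int x) (?T l f)) 0)"
      unfolding sum_fun_apply scl_apply
    proof (rule sum.mono_neutral_right)
      have "?E (1 + l - int x) (?T (L - int x) (?T l f)) 0 = 0" if "x \<noteq> nat (1 + l)" for x
      proof -
        have "1 + l - int x < 0 \<or> 1 + l - int x > 0" using that l by auto
        then show ?thesis by (auto simp: exp_mode_neg exp_mode_eq_0 zero_fun_apply)
      qed
      then show "\<forall>x\<in>{..<M} - {nat (1 + l)}.
          reflect_coeff (int x) * ?E (1 + l - int x) (?T (L - int x) (?T l f)) 0 = 0" by simp
    qed (use l in \<open>auto simp: M_def\<close>)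
    also have "\<dots> = - 2 * (-1) ^ nat l * ?T l (?T (L - 1 - l) f) 0"
    proof -
      obtain n where n: "l = int n" using l nonneg_int_cases by auto
      then have "nat (1 + l) = Suc n" "1 + l - int (Suc n) = 0" "L - int (Suc n) = L - 1 - l" by auto
      moreover have "reflect_coeff (int (Suc n)) = (- 2 * (-1) ^ nat l :: 'a)"
        unfolding n by (simp add: reflect_coeff_def)
      ultimately show ?thesis
        by (simp add: shift_mode_commute[of "- 2" a l] diff_diff_eq)
    qed
    finally show "?T L (?E (1 + l) (?T l f)) 0 = - 2 * shift_mode 2 a l (?T (L - 1 - l) f) 0"
      using shift_mode_uminus[of "- 2" a l "?T (L - 1 - l) f"] by (simp add: scl_apply)
  qed
  also have "\<dots> = - 2 * (\<Sum>l\<in>{0..L - 1}. shift_mode 2 a l (?T (L - 1 - l) f)) 0"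
    by (simp add: sum_distrib_left sum_fun_apply)
  also have "\<dots> = (if L = 1 then - 2 * f 0 else 0)"
    unfolding sum_shift_modes_inverse by (simp add: zero_fun_apply)
  finally show ?thesis .
qed

text \<open>The neutral fermion relations. By the previous relation the anticommutator depends on \<open>i\<close>
  only through a sign, so it commutes with all derivatives, and for \<open>i = 1\<close> it can be evaluated
  at the origin.\<close>

theorem vertex_mode_anticommute:
  "vertex_mode a i (vertex_mode a j f) + vertex_mode a j (vertex_mode a i f) =
   scl (if i + j = 0 then 2 * sg i else 0) f"
proof -
  define D where "D i j f = vertex_mode a i (vertex_mode a j f) + vertex_mode a j (vertex_mode a i f)"
    for i j and f :: "'a tser"
  \<comment> \<open>The normally ordered right-hand sides are symmetric and cancel in the
    anticommutator.\<close>
  have step: "D (i - 1) j f = - D i (j - 1) f" for i j f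
  proof -
    have "D (i - 1) j f + D i (j - 1) f =
      (vertex_mode a (i - 1) (vertex_mode a j f) + vertex_mode a i (vertex_mode a (j - 1) f)) +
      (vertex_mode a (j - 1) (vertex_mode a i f) + vertex_mode a j (vertex_mode a (i - 1) f))"
      by (simp add: D_def algebra_simps)
    also have "\<dots> = 0"
      unfolding vertex_mode_normal_mode normal_mode_commute[of a a i]
        normal_mode_commute[of a a "i - 1"] by simp
    finally show ?thesis by (simp add: eq_neg_iff_add_eq_0)
  qed
  have shift: "D i j f = scl (sg k) (D (i + k) (j - k) f)" for i j k f
  proof (induction k rule: int_induct[where k=0])
    case base
    then show ?case by simp
  next
    case (step1 k)
    have "D (i + k) (j - k) f = - D (i + (k + 1)) (j - (k + 1)) f"
      using step[of "i + k + 1" "j - k" f] by (simp add: algebra_simps)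
    then show ?case unfolding step1.IH by (auto simp: pointwise sg_def fun_Compl_def)
  next
    case (step2 k)
    have "D (i + k) (j - k) f = - D (i + (k - 1)) (j - (k - 1)) f"
      using step[of "i + k" "j - k + 1" f] by (simp add: algebra_simps)
    then show ?case unfolding step2.IH by (auto simp: pointwise sg_def fun_Compl_def)
  qed
  \<comment> \<open>A nonconstant monomial contains some variable, and the derivative by it reads
    off the coefficient at a lower monomial, up to a nonzero integer. Since f varies, the induction
    hypothesis applies to the derivative of f.\<close>
  have "D i j f m = (if i + j = 0 then 2 * sg i * f m else 0)" for i j f m
  proof (induction "wt m" arbitrary: m f i j rule: less_induct)
    case less
    show ?case
    proof (cases "m = 0")
      case True
      \<comment> \<open>Moving to first index 1 makes the product with phi_1 on the outside vanish
        at the origin, so a single product has to be evaluated.\<close>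
      have "D i j f 0 = sg (1 - i) * D 1 (i + j - 1) f 0"
        by (subst shift[of i j f "1 - i"]) (simp add: scl_apply algebra_simps)
      also have "D 1 (i + j - 1) f 0 = shift_mode (- 2) a (1 - (i + j)) (vertex_mode a 1 f) 0"
        by (simp add: D_def plus_fun_apply vertex_mode_at_0[of a "i + j - 1"] vertex_mode_eq_0)
      also have "sg (1 - i) * \<dots> = (if i + j = 0 then 2 * sg i * f 0 else 0)"
      proof -
        have "sg (1 - i) = (- sg i :: 'a)" by (simp add: sg_def)
        then show ?thesis unfolding shift_mode_vertex_mode_1_at_0
          by (simp only: add.commute[of i] diff_eq_eq eq_diff_eq) simp
      qed
      finally show ?thesis using True by simp
    next
      case False
      then obtain v where v: "Poly_Mapping.lookup m v \<noteq> 0"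
        using poly_mapping_eqI[of m 0] by (simp only: lookup_zero) blast
      define u where "u = (Poly_Mapping.single v 1 :: mono)"
      define m' where "m' = m - u"
      have m: "m = m' + u"
        unfolding m'_def u_def using v
        by (intro poly_mapping_eqI) (auto simp: lookup_add lookup_minus lookup_single when_def)
      have wt: "wt m' < wt m" unfolding m by (simp add: u_def oddidx_def)
      obtain b n where v': "v = (b, n)" by (cases v)
      have "tderiv v (D i j f) = D i j (tderiv v f) + (if a = b then D (i - odd_of n) j f + D i (j - odd_of n) f else 0)"
        unfolding v' D_def
        by (simp add: tlinearD[OF tlinear_tderiv] tlinearD[OF tlinear_vertex_mode] tderiv_vertex_mode algebra_simps)
      \<comment> \<open>The two corrections are related by an odd index shift, hence are
        opposite.\<close>
      also have "D (i - odd_of n) j f + D i (j - odd_of n) f = 0"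
      proof -
        have "sg (odd_of n) = (- 1 :: 'a)" by (simp add: sg_def odd_of_def)
        then show ?thesis using shift[of "i - odd_of n" j f "odd_of n"] by (simp add: pointwise)
      qed
      finally have "tderiv v (D i j f) m' = D i j (tderiv v f) m'" by simp
      also have "\<dots> = (if i + j = 0 then 2 * sg i * tderiv v f m' else 0)"
        by (rule less) fact
      finally have "of_nat (Poly_Mapping.lookup m' v + 1) * D i j f m =
          of_nat (Poly_Mapping.lookup m' v + 1) * (if i + j = 0 then 2 * sg i * f m else 0)"
        unfolding tderiv_def m u_def by simp
      moreover have "(of_nat (Poly_Mapping.lookup m' v + 1) :: 'a) \<noteq> 0"
        unfolding of_nat_eq_0_iff by simp
      ultimately show ?thesis by (simp only: mult_cancel_left simp_thms)
    qed
  qed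
  then show ?thesis unfolding D_def by (auto simp: pointwise)
qed

lemma vertex_mode_exchange:
  "vertex_mode a i (vertex_mode b j f) = scl (if a = b then - 1 else 1) (vertex_mode b j (vertex_mode a i f))
     + scl (if a = b \<and> i + j = 0 then 2 * sg i else 0) f"
proof (cases "a = b")
  case True
  then show ?thesis
    using vertex_mode_anticommute[of a i j f] by (auto simp: pointwise algebra_simps)
next
  case False
  then show ?thesis using vertex_mode_commute_diff[OF False] by simp
qed

section \<open>Modes as sums over splittings of a monomial\<close>

lemma exp_mode_splittings:
  "exp_mode a k f m = (\<Sum>(p, q)\<in>{(p, q). p + q = m}.
     if on_comp a q \<and> int (wt q) = k then f p / of_nat (mfact q) else 0)"
proof -
  have "exp_mode a k f m = (\<Sum>q\<in>{q \<in> comp_monos a k. \<exists>p. p + q = m}. f (m - q) / of_nat (mfact q))"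
    unfolding exp_mode_def by (rule sum.inter_filter[symmetric]) simp
  also have "\<dots> = (\<Sum>(p, q)\<in>{x \<in> {(p, q). p + q = m}. on_comp a (snd x) \<and> int (wt (snd x)) = k}.
      f p / of_nat (mfact q))"
    by (rule sum.reindex_bij_witness[of _ snd "\<lambda>q. (m - q, q)"]) (auto simp: comp_monos_def)
  also have "\<dots> = (\<Sum>(p, q)\<in>{(p, q). p + q = m}.
     if on_comp a q \<and> int (wt q) = k then f p / of_nat (mfact q) else 0)"
    by (subst sum.inter_filter[OF finite_splittings]) (auto intro!: sum.cong simp: split_def)
  finally show ?thesis .
qed

text \<open>In a splitting m = p + q the exponential takes the weight of q, which forces the index
  of the translation mode. This is the shape in which \<open>bil_side\<close> is written.\<close>

lemma vertex_mode_splittings: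
  "vertex_mode a n f m = (\<Sum>(p, q)\<in>{(p, q). p + q = m}.
     if on_comp a q then shift_mode (- 2) a (int (wt q) - n) f p / of_nat (mfact q) else 0)"
proof -
  have "vertex_mode a n f m = (\<Sum>x\<in>{(p, q). p + q = m}. \<Sum>l\<in>{0..int (wt m) - n}.
     if on_comp a (snd x) \<and> int (wt (snd x)) = n + l
     then shift_mode (- 2) a l f (fst x) / of_nat (mfact (snd x)) else 0)"
    unfolding vertex_mode_def exp_mode_splittings split_def by (rule sum.swap)
  also have "\<dots> = (\<Sum>x\<in>{(p, q). p + q = m}.
     if on_comp a (snd x) then shift_mode (- 2) a (int (wt (snd x)) - n) f (fst x) / of_nat (mfact (snd x)) else 0)"
  proof (rule sum.cong[OF refl])
    fix x assume "x \<in> {(p, q). p + q = m}"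
    then have wt: "wt (snd x) \<le> wt m" by auto
    let ?l = "int (wt (snd x)) - n"
    let ?t = "\<lambda>l. shift_mode (- 2) a l f (fst x) / of_nat (mfact (snd x))"
    have "(\<Sum>l\<in>{0..int (wt m) - n}. if on_comp a (snd x) \<and> int (wt (snd x)) = n + l then ?t l else 0)
      = (\<Sum>l\<in>{0..int (wt m) - n}. if l = ?l then if on_comp a (snd x) then ?t l else 0 else 0)"
      by (intro sum.cong) auto
    also have "\<dots> = (if on_comp a (snd x) then ?t ?l else 0)"
      using wt by (auto simp: sum.delta shift_mode_neg zero_fun_apply)
    finally show "(\<Sum>l\<in>{0..int (wt m) - n}. if on_comp a (snd x) \<and> int (wt (snd x)) = n + l then ?t l else 0)
      = (if on_comp a (snd x) then ?t ?l else 0)" .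
  qed
  finally show ?thesis by (simp add: split_def)
qed

text \<open>All times have odd index, so degree and weight have the same parity.\<close>

lemma minus_one_power_deg: "(-1 :: 'k::ring_1) ^ deg e = (-1) ^ wt e"
proof -
  have "wt e = deg e + 2 * (\<Sum>v\<in>Poly_Mapping.keys e. Poly_Mapping.lookup e v * snd v)"
    unfolding wt_def deg_def oddidx_def by (simp add: sum_distrib_left sum.distrib algebra_simps)
  then show ?thesis by (simp add: power_add power_mult)
qed

lemma sg_of_nat: "sg (int n) = (-1) ^ n"
  by (simp add: sg_def)

subsection \<open>The bilinear form\<close>

text \<open>Polarised, because the cross terms of tau + C X tau have two different arguments. The
  factor e^(-xi(t'^(c), z)) g(t' + 2[z^(-1)]_c) is X_c(-z) g, the origin of the sign; the residue
  pairs index n with -n.\<close>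

definition bilin :: "comp \<Rightarrow> 'k::field_char_0 tser \<Rightarrow> 'k tser \<Rightarrow> mono \<Rightarrow> mono \<Rightarrow> 'k" where
  "bilin c f g m m' = (\<Sum>n\<in>{- int (wt m')..int (wt m)}. sg n * vertex_mode c n f m * vertex_mode c (- n) g m')"

lemma bilin_eq:
  assumes "K \<le> - int (wt m')" "L \<ge> int (wt m)"
  shows "bilin c f g m m' = (\<Sum>n\<in>{K..L}. sg n * vertex_mode c n f m * vertex_mode c (- n) g m')"
  unfolding bilin_def
  by (rule sum.mono_neutral_left) (use assms in \<open>auto simp: vertex_mode_eq_0 not_le\<close>)

lemma bilin_commute: "bilin c f g m m' = bilin c g f m' m"
  unfolding bilin_def
  by (rule sum.reindex_bij_witness[of _ uminus uminus]) auto

lemma bil_side_eq_bilin: "bil_side f c m m' = bilin c f f m m'"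
proof -
  let ?T = "shift_mode (- 2) c"
  let ?P = "\<lambda>m. {(p, q). p + q = (m :: mono)}"
  let ?v = "\<lambda>n x. if on_comp c (snd x) then ?T (int (wt (snd x)) - n) f (fst x) / of_nat (mfact (snd x)) else 0"
  have "bilin c f f m m' = (\<Sum>n\<in>{- int (wt m')..int (wt m)}. \<Sum>x\<in>?P m. \<Sum>y\<in>?P m'. sg n * ?v n x * ?v (- n) y)"
    unfolding bilin_def vertex_mode_splittings split_def
    by (intro sum.cong refl) (simp only: mult.assoc sum_product, simp only: sum_distrib_left)
  also have "\<dots> = (\<Sum>x\<in>?P m. \<Sum>y\<in>?P m'. \<Sum>n\<in>{- int (wt m')..int (wt m)}. sg n * ?v n x * ?v (- n) y)"
    by (subst sum.swap, rule sum.cong[OF refl], rule sum.swap)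
  also have "\<dots> = (\<Sum>x\<in>?P m. \<Sum>y\<in>?P m'.
        (if on_comp c (snd x) \<and> on_comp c (snd y) then
           (\<Sum>k\<in>{..wt (snd x) + wt (snd y)}. shiftc (- 2) c f k (fst x) * shiftc 2 c f (wt (snd x) + wt (snd y) - k) (fst y))
           * ((-1) ^ deg (snd y) / of_nat (mfact (snd x) * mfact (snd y)))
         else 0))"
  proof (intro sum.cong refl)
    fix x y assume xy: "x \<in> ?P m" "y \<in> ?P m'"
    define X where "X = int (wt (snd x))"
    define Y where "Y = int (wt (snd y))"
    define W where "W = wt (snd x) + wt (snd y)"
    have le: "X \<le> int (wt m)" "Y \<le> int (wt m')" "0 \<le> X" "0 \<le> Y" "int W = X + Y"
      using xy by (auto simp: X_def Y_def W_def)
    have *: "(\<Sum>n\<in>{- int (wt m')..int (wt m)}. sg n * (?T (X - n) f (fst x) * ?T (Y + n) f (fst y)))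
      = (\<Sum>k\<in>{..W}. shiftc (- 2) c f k (fst x) * shiftc 2 c f (W - k) (fst y)) * (-1) ^ deg (snd y)"
    proof -
      \<comment> \<open>Outside the smaller window one of the two translation modes has negative
        index.\<close>
      have "(\<Sum>n\<in>{- int (wt m')..int (wt m)}. sg n * (?T (X - n) f (fst x) * ?T (Y + n) f (fst y)))
        = (\<Sum>n\<in>{- Y..X}. sg n * (?T (X - n) f (fst x) * ?T (Y + n) f (fst y)))"
        by (rule sum.mono_neutral_right)
           (use le in \<open>auto simp: shift_mode_neg zero_fun_apply not_le\<close>)
      also have "\<dots> = (\<Sum>k\<in>{..W}. sg (X - int k) * (?T (int k) f (fst x) * ?T (int (W - k)) f (fst y)))"
        by (rule sum.reindex_bij_witness[of _ "\<lambda>k. X - int k" "\<lambda>n. nat (X - n)"])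
           (use le in \<open>auto simp: of_nat_diff algebra_simps\<close>)
      also have "\<dots> = (\<Sum>k\<in>{..W}. shiftc (- 2) c f k (fst x) * shiftc 2 c f (W - k) (fst y) * (-1) ^ deg (snd y))"
      proof (intro sum.cong refl)
        fix k assume k: "k \<in> {..W}"
        have 1: "shiftc (- 2) c f k (fst x) = ?T (int k) f (fst x)" by (simp add: shift_mode_def)
        have "shiftc 2 c f (W - k) (fst y) = shift_mode (- (- 2)) c (int (W - k)) f (fst y)"
          by (simp add: shift_mode_def)
        also have "\<dots> = (-1) ^ (W - k) * ?T (int (W - k)) f (fst y)"
          unfolding shift_mode_uminus scl_apply by simp
        finally have 2: "shiftc 2 c f (W - k) (fst y) = sg (int (W - k)) * ?T (int (W - k)) f (fst y)"
          by (simp only: sg_of_nat)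
        have 3: "(-1) ^ deg (snd y) = (sg Y :: 'a)"
          by (simp add: minus_one_power_deg Y_def sg_of_nat)
        \<comment> \<open>Translation by 2 contributes (-1)^(W-k) and the exponential of -xi
          contributes (-1)^Y; together they form the sign of the mode index X - k.\<close>
        have "X - int k = int (W - k) + - Y" using k le by (simp add: of_nat_diff)
        then have "(sg (X - int k) :: 'a) = sg (int (W - k)) * sg Y" by (simp only: sg_add sg_simps)
        then show "sg (X - int k) * (?T (int k) f (fst x) * ?T (int (W - k)) f (fst y)) =
          shiftc (- 2) c f k (fst x) * shiftc 2 c f (W - k) (fst y) * (-1) ^ deg (snd y)"
          unfolding 1 2 3 by (simp only: mult_ac)
      qed
      finally show ?thesis by (simp only: sum_distrib_right)
    qed
    show "(\<Sum>n\<in>{- int (wt m')..int (wt m)}. sg n * ?v n x * ?v (- n) y) =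
        (if on_comp c (snd x) \<and> on_comp c (snd y) then
           (\<Sum>k\<in>{..wt (snd x) + wt (snd y)}. shiftc (- 2) c f k (fst x) * shiftc 2 c f (wt (snd x) + wt (snd y) - k) (fst y))
           * ((-1) ^ deg (snd y) / of_nat (mfact (snd x) * mfact (snd y)))
         else 0)"
    proof (cases "on_comp c (snd x) \<and> on_comp c (snd y)")
      case True
      then have "(\<Sum>n\<in>{- int (wt m')..int (wt m)}. sg n * ?v n x * ?v (- n) y) =
        (\<Sum>n\<in>{- int (wt m')..int (wt m)}. sg n * (?T (X - n) f (fst x) * ?T (Y + n) f (fst y)))
          * (1 / of_nat (mfact (snd x) * mfact (snd y)))"
        by (simp add: sum_divide_distrib X_def Y_def mult.assoc)
      then show ?thesis unfolding * using True by (simp add: W_def)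
    qed auto
  qed
  finally show ?thesis unfolding bil_side_def split_def by simp
qed

lemma bilin_local:
  assumes "\<And>p. wt p \<le> wt m + wt m' \<Longrightarrow> f p = f' p" "\<And>p. wt p \<le> wt m + wt m' \<Longrightarrow> g p = g' p"
  shows "bilin c f g m m' = bilin c f' g' m m'"
proof -
  have "vertex_mode c n f m = vertex_mode c n f' m" "vertex_mode c (- n) g m' = vertex_mode c (- n) g' m'"
    if "n \<in> {- int (wt m')..int (wt m)}" for n
    using that by (auto intro!: vertex_mode_local assms)
  then show ?thesis unfolding bilin_def by (intro sum.cong) auto
qed

lemma bilin_add_left: "bilin c (f + g) h m m' = bilin c f h m m' + bilin c g h m m'"
  by (simp add: bilin_def tlinearD[OF tlinear_vertex_mode] plus_fun_apply sum.distrib algebra_simps)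

lemma bilin_scl_left: "bilin c (scl u f) h m m' = u * bilin c f h m m'"
  by (simp add: bilin_def tlinearD[OF tlinear_vertex_mode] scl_apply sum_distrib_left algebra_simps)

lemma bilin_zero_left: "bilin c 0 h m m' = 0"
  by (simp add: bilin_def tlinearD[OF tlinear_vertex_mode] zero_fun_apply)

lemma bilin_sum_left: "bilin c (sum F A) h m m' = (\<Sum>x\<in>A. bilin c (F x) h m m')"
  by (induction A rule: infinite_finite_induct) (simp_all add: bilin_zero_left bilin_add_left)

lemma bilin_add_right: "bilin c h (f + g) m m' = bilin c h f m m' + bilin c h g m m'"
  by (simp add: bilin_commute[of c h] bilin_add_left)

lemma bilin_scl_right: "bilin c h (scl u f) m m' = u * bilin c h f m m'"
  by (simp add: bilin_commute[of c h] bilin_scl_left)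

lemma bilin_sum_right: "bilin c h (sum F A) m m' = (\<Sum>x\<in>A. bilin c h (F x) m m')"
  by (simp add: bilin_commute[of c h] bilin_sum_left)

section \<open>The part linear in the constant\<close>

abbreviation "exch a b \<equiv> (if a = b then - 1 else 1)"

text \<open>phi_n is moved to the right through both factors. The exchange signs multiply the form
  itself, while the scalar terms of the fermion relations select n = -j and n = -i and leave
  products of single coefficients.\<close>

lemma bilin_pair_left:
  fixes f g :: "'k::field_char_0 tser"
  shows "bilin c (vertex_mode a i (vertex_mode b j f)) g m m' =
     exch c a * exch c b * vertex_mode a i (vertex_mode b j (\<lambda>p. bilin c f g p m')) m
     + (if c = b then 2 * exch c a * vertex_mode a i f m * vertex_mode b j g m' else 0)
     + (if c = a then 2 * vertex_mode b j f m * vertex_mode a i g m' else 0)"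
proof -
  \<comment> \<open>The window contains -i and -j and suffices for every coefficient of the form
    that the two outer modes look at.\<close>
  define L where "L = int (wt m) + int (wt m') + \<bar>i\<bar> + \<bar>j\<bar>"
  let ?V = "vertex_mode"
  let ?s = "\<lambda>n. sg n * ?V c (- n) g m'"
  have X: "?V c n (?V a i (?V b j f)) m = exch c a * exch c b * ?V a i (?V b j (?V c n f)) m
     + (if n = - j then if c = b then 2 * exch c a * sg n * ?V a i f m else 0 else 0)
     + (if n = - i then if c = a then 2 * sg n * ?V b j f m else 0 else 0)" for n
  proof -
    have "?V c n (?V a i (?V b j f)) = scl (exch c a) (?V a i (scl (exch c b) (?V b j (?V c n f))
       + scl (if c = b \<and> n + j = 0 then 2 * sg n else 0) f))
       + scl (if c = a \<and> n + i = 0 then 2 * sg n else 0) (?V b j f)"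
      unfolding vertex_mode_exchange[of c n a] vertex_mode_exchange[of c n b] ..
    then show ?thesis
      by (auto simp: tlinearD[OF tlinear_vertex_mode] plus_fun_apply scl_apply zero_fun_apply algebra_simps
          add_eq_0_iff2)
  qed
  have 1: "(\<Sum>n\<in>{- L..L}. ?s n * ?V a i (?V b j (?V c n f)) m) =
      ?V a i (?V b j (\<lambda>p. bilin c f g p m')) m"
  proof -
    have "(\<Sum>n\<in>{- L..L}. ?s n * ?V a i (?V b j (?V c n f)) m)
        = ?V a i (?V b j (\<Sum>n\<in>{- L..L}. scl (?s n) (?V c n f))) m"
      by (simp add: tlinearD[OF tlinear_vertex_mode] sum_fun_apply scl_apply)
    also have "\<dots> = ?V a i (?V b j (\<lambda>p. bilin c f g p m')) m"
    proof (intro vertex_mode_local)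
      fix p q assume "int (wt p) = int (wt m) - i" "int (wt q) = int (wt p) - j"
      then show "(\<Sum>n\<in>{- L..L}. scl (?s n) (?V c n f)) q = bilin c f g q m'"
        by (subst bilin_eq[of "- L" m' q L])
           (auto simp: L_def sum_fun_apply scl_apply intro!: sum.cong)
    qed
    finally show ?thesis .
  qed
  have "bilin c (?V a i (?V b j f)) g m m' = (\<Sum>n\<in>{- L..L}. ?s n * ?V c n (?V a i (?V b j f)) m)"
    by (subst bilin_eq[of "- L" m' m L]) (auto simp: L_def algebra_simps)
  also have "\<dots> = exch c a * exch c b * (\<Sum>n\<in>{- L..L}. ?s n * ?V a i (?V b j (?V c n f)) m)
     + (\<Sum>n\<in>{- L..L}. if n = - j then if c = b then ?s n * (2 * exch c a * sg n * ?V a i f m) else 0 else 0)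
     + (\<Sum>n\<in>{- L..L}. if n = - i then if c = a then ?s n * (2 * sg n * ?V b j f m) else 0 else 0)"
    unfolding X sum_distrib_left sum.distrib[symmetric]
    by (intro sum.cong refl) (simp add: algebra_simps)
  also have "\<dots> = exch c a * exch c b * ?V a i (?V b j (\<lambda>p. bilin c f g p m')) m
     + (if c = b then 2 * exch c a * ?V a i f m * ?V b j g m' else 0)
     + (if c = a then 2 * ?V b j f m * ?V a i g m' else 0)"
  proof -
    have *: "- j \<in> {- L..L}" "- i \<in> {- L..L}" by (auto simp: L_def)
    \<comment> \<open>The sign in the form and the sign in the anticommutator occur at the same
      index and cancel.\<close>
    have sg: "sg k * u * (x * sg k * y) = x * y * u" for k and x y u :: 'k
    proof -
      have "sg k * sg k = (1 :: 'k)" by simp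
      then have "x * y * u * (sg k * sg k) = x * y * u" by simp
      then show ?thesis by (simp add: mult_ac)
    qed
    show ?thesis unfolding 1 sum.delta[OF finite_atLeastAtMost_int] using * by (simp add: sg)
  qed
  finally show ?thesis .
qed

text \<open>The sign \<open>exch c a * exch c b\<close> does not depend on c. For a = b the leftover
  products are antisymmetric in the two arguments and cancel after symmetrisation; for a, b
  different both components leave the same symmetrised products.\<close>

lemma bilin_pair_symmetric:
  fixes f :: "'k::field_char_0 tser"
  assumes "\<And>m m'. bilin Cmp1 f f m m' = bilin Cmp2 f f m m'"
  defines "g \<equiv> \<lambda>a b i j. vertex_mode a i (vertex_mode b j f)"
  shows "bilin Cmp1 (g a b i j) f m m' + bilin Cmp1 f (g a b i j) m m'
       = bilin Cmp2 (g a b i j) f m m' + bilin Cmp2 f (g a b i j) m m'"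
  unfolding g_def bilin_commute[of _ f "vertex_mode a i (vertex_mode b j f)"] bilin_pair_left assms(1)
  by (cases a; cases b) (simp_all add: algebra_simps)

section \<open>Exponentials preserving the bilinear identity\<close>

definition bilin_diff :: "'k::field_char_0 tser \<Rightarrow> 'k tser \<Rightarrow> mono \<Rightarrow> mono \<Rightarrow> 'k" where
  "bilin_diff f g m m' = bilin Cmp1 f g m m' - bilin Cmp2 f g m m'"

lemma bilin_diff_scl_left: "bilin_diff (scl u f) h m m' = u * bilin_diff f h m m'"
  and bilin_diff_scl_right: "bilin_diff h (scl u f) m m' = u * bilin_diff h f m m'"
  and bilin_diff_sum_left: "bilin_diff (sum F A) h m m' = (\<Sum>x\<in>A. bilin_diff (F x) h m m')"
  and bilin_diff_sum_right: "bilin_diff h (sum F A) m m' = (\<Sum>x\<in>A. bilin_diff h (F x) m m')"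
  and bilin_diff_zero_left: "bilin_diff 0 h m m' = 0"
  and bilin_diff_zero_right: "bilin_diff h 0 m m' = 0"
  by (simp_all add: bilin_diff_def bilin_scl_left bilin_scl_right bilin_sum_left bilin_sum_right
      sum_subtractf algebra_simps bilin_zero_left bilin_commute[of _ h 0])

lemma is_2bkp_tau_iff: "is_2bkp_tau f \<longleftrightarrow> (\<forall>m m'. bilin_diff f f m m' = 0)"
  by (simp add: is_2bkp_tau_def bil_side_eq_bilin bilin_diff_def)

text \<open>An operator \<open>A\<close> which shifts the index of the vertex modes by an odd number upon commutation:
  the two correction terms of \<open>A \<otimes> 1 + 1 \<otimes> A\<close> cancel in the bilinear form.\<close>

definition odd_shifting :: "('k::field_char_0 tser \<Rightarrow> 'k tser) \<Rightarrow> bool" where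
  "odd_shifting A \<longleftrightarrow> tlinear A \<and>
     (\<forall>m. \<exists>W. \<forall>f g. (\<forall>p. wt p \<le> W \<longrightarrow> f p = g p) \<longrightarrow> A f m = A g m) \<and>
     (\<exists>d \<gamma>. odd d \<and> (\<forall>c n f. vertex_mode c n (A f) = A (vertex_mode c n f) - scl (\<gamma> c) (vertex_mode c (n + d) f)))"

lemma odd_shifting_tderiv: "odd_shifting (\<lambda>f. scl s (tderiv (a, i) f))"
  unfolding odd_shifting_def
proof (intro conjI allI)
  show "tlinear (\<lambda>f. scl s (tderiv (a, i) f))"
    by (rule tlinear_comp[OF tlinear_scl tlinear_tderiv])
  show "\<exists>W. \<forall>f g. (\<forall>p. wt p \<le> W \<longrightarrow> f p = g p) \<longrightarrow> scl s (tderiv (a, i) f) m = scl s (tderiv (a, i) g) m" for m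
    by (intro exI[of _ "wt (m + Poly_Mapping.single (a, i) 1)"]) (simp add: scl_apply tderiv_def)
  show "\<exists>d \<gamma>. odd d \<and> (\<forall>c n f. vertex_mode c n (scl s (tderiv (a, i) f)) =
      scl s (tderiv (a, i) (vertex_mode c n f)) - scl (\<gamma> c) (vertex_mode c (n + d) f))"
    by (intro exI[of _ "- odd_of i"] exI[of _ "\<lambda>c. if c = a then s else 0"])
       (auto simp: odd_of_def tderiv_vertex_mode tlinearD[OF tlinear_vertex_mode] scl_add_right algebra_simps)
qed

lemma odd_shifting_tmult: "odd_shifting (\<lambda>f. scl s (tmult (a, i) f))"
  unfolding odd_shifting_def
proof (intro conjI allI)
  show "tlinear (\<lambda>f. scl s (tmult (a, i) f))"
    by (rule tlinear_comp[OF tlinear_scl tlinear_tmult])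
  show "\<exists>W. \<forall>f g. (\<forall>p. wt p \<le> W \<longrightarrow> f p = g p) \<longrightarrow> scl s (tmult (a, i) f) m = scl s (tmult (a, i) g) m" for m
    by (intro exI[of _ "wt (m - Poly_Mapping.single (a, i) 1)"]) (simp add: scl_apply tmult_def)
  show "\<exists>d \<gamma>. odd d \<and> (\<forall>c n f. vertex_mode c n (scl s (tmult (a, i) f)) =
      scl s (tmult (a, i) (vertex_mode c n f)) - scl (\<gamma> c) (vertex_mode c (n + d) f))"
    by (intro exI[of _ "odd_of i"] exI[of _ "\<lambda>c. if c = a then s * (2 / of_int (odd_of i)) else 0"])
       (auto simp: odd_of_def tmult_vertex_mode tlinearD[OF tlinear_vertex_mode] scl_add_right algebra_simps)
qed

lemma bilin_odd_shifting:
  assumes A: "odd_shifting A"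
  shows "bilin c (A f) g m m' + bilin c f (A g) m m' =
    A (\<lambda>p. bilin c f g p m') m + A (\<lambda>p. bilin c f g m p) m'"
proof -
  obtain d \<gamma> where d: "odd d" and V: "\<And>c n f. vertex_mode c n (A f) = A (vertex_mode c n f) - scl (\<gamma> c) (vertex_mode c (n + d) f)"
    using A unfolding odd_shifting_def by blast
  have lin: "tlinear A" using A by (simp add: odd_shifting_def)
  obtain W where W: "\<And>f g. (\<And>p. wt p \<le> W \<Longrightarrow> f p = g p) \<Longrightarrow> A f m = A g m"
    using A unfolding odd_shifting_def by blast
  obtain W' where W': "\<And>f g. (\<And>p. wt p \<le> W' \<Longrightarrow> f p = g p) \<Longrightarrow> A f m' = A g m'"
    using A unfolding odd_shifting_def by blast
  \<comment> \<open>Large enough for every coefficient on which \<open>A\<close> may depend and for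
    the index shift by d.\<close>
  define L where "L = int (wt m) + int (wt m') + int W + int W' + \<bar>d\<bar>"
  let ?V = "vertex_mode c"
  have 1: "A (\<lambda>p. bilin c f g p m') m = (\<Sum>n\<in>{- L..L}. sg n * A (?V n f) m * ?V (- n) g m')"
  proof -
    have "A (\<lambda>p. bilin c f g p m') m = A (\<Sum>n\<in>{- L..L}. scl (sg n * ?V (- n) g m') (?V n f)) m"
    proof (rule W)
      fix p assume "wt p \<le> W"
      then show "bilin c f g p m' = (\<Sum>n\<in>{- L..L}. scl (sg n * ?V (- n) g m') (?V n f)) p"
        by (subst bilin_eq[of "- L" m' p L]) (auto simp: L_def sum_fun_apply scl_apply intro!: sum.cong)
    qed
    then show ?thesis by (simp add: tlinearD[OF lin] sum_fun_apply scl_apply mult_ac)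
  qed
  have 2: "A (\<lambda>p. bilin c f g m p) m' = (\<Sum>n\<in>{- L..L}. sg n * ?V n f m * A (?V (- n) g) m')"
  proof -
    have "A (\<lambda>p. bilin c f g m p) m' = A (\<Sum>n\<in>{- L..L}. scl (sg n * ?V n f m) (?V (- n) g)) m'"
    proof (rule W')
      fix p assume "wt p \<le> W'"
      then show "bilin c f g m p = (\<Sum>n\<in>{- L..L}. scl (sg n * ?V n f m) (?V (- n) g)) p"
        by (subst bilin_eq[of "- L" p m L]) (auto simp: L_def sum_fun_apply scl_apply intro!: sum.cong)
    qed
    then show ?thesis by (simp add: tlinearD[OF lin] sum_fun_apply scl_apply mult_ac)
  qed
  \<comment> \<open>Reindexing by the odd number d reverses the sign (-1)^n.\<close>
  have 3: "(\<Sum>n\<in>{- L..L}. sg n * ?V (n + d) f m * ?V (- n) g m') =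
      - (\<Sum>n\<in>{- L..L}. sg n * ?V n f m * ?V (- n + d) g m')"
  proof -
    have "(\<Sum>n\<in>{- L..L}. sg n * ?V n f m * ?V (- n + d) g m')
        = (\<Sum>n\<in>{- L - d..L - d}. sg (n + d) * ?V (n + d) f m * ?V (- n) g m')"
      by (rule sum.reindex_bij_witness[of _ "\<lambda>n. n + d" "\<lambda>n. n - d"]) auto
    also have "\<dots> = (\<Sum>n\<in>{- L..L}. sg (n + d) * ?V (n + d) f m * ?V (- n) g m')"
    proof (rule sum.mono_neutral_cong)
      fix n assume "n \<in> {- L..L} - {- L - d..L - d}"
      then have "n + d > int (wt m) \<or> - n > int (wt m')" by (auto simp: L_def)
      then show "sg (n + d) * ?V (n + d) f m * ?V (- n) g m' = 0" by (auto simp: vertex_mode_eq_0)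
    next
      fix n assume "n \<in> {- L - d..L - d} - {- L..L}"
      then have "n + d > int (wt m) \<or> - n > int (wt m')" by (auto simp: L_def)
      then show "sg (n + d) * ?V (n + d) f m * ?V (- n) g m' = 0" by (auto simp: vertex_mode_eq_0)
    qed auto
    also have "\<dots> = - (\<Sum>n\<in>{- L..L}. sg n * ?V (n + d) f m * ?V (- n) g m')"
    proof -
      have "(sg (n + d) :: 'a) = - sg n" for n using d by (auto simp: sg_def)
      then show ?thesis by (simp add: sum_negf)
    qed
    finally show ?thesis by simp
  qed
  have "bilin c (A f) g m m' + bilin c f (A g) m m' =
     (\<Sum>n\<in>{- L..L}. sg n * ?V n (A f) m * ?V (- n) g m') + (\<Sum>n\<in>{- L..L}. sg n * ?V n f m * ?V (- n) (A g) m')"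
    by (subst (1 2) bilin_eq[of "- L" m' m L]) (auto simp: L_def)
  also have "\<dots> = ((\<Sum>n\<in>{- L..L}. sg n * A (?V n f) m * ?V (- n) g m') + (\<Sum>n\<in>{- L..L}. sg n * ?V n f m * A (?V (- n) g) m'))
     - \<gamma> c * ((\<Sum>n\<in>{- L..L}. sg n * ?V (n + d) f m * ?V (- n) g m')
            + (\<Sum>n\<in>{- L..L}. sg n * ?V n f m * ?V (- n + d) g m'))"
    unfolding V minus_apply[of _ _ m] minus_apply[of _ _ m'] scl_apply
      sum_distrib_left sum.distrib[symmetric] sum_subtractf[symmetric]
    by (intro sum.cong refl) (simp add: algebra_simps)
  finally show ?thesis unfolding 1 2 3 by simp
qed

lemma bilin_diff_odd_shifting:
  assumes A: "odd_shifting A"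
  shows "bilin_diff (A f) g m m' + bilin_diff f (A g) m m' =
    A (\<lambda>p. bilin_diff f g p m') m + A (\<lambda>p. bilin_diff f g m p) m'"
proof -
  have lin: "tlinear A" using A by (simp add: odd_shifting_def)
  have e: "(\<lambda>p. bilin_diff f g p m') = (\<lambda>p. bilin Cmp1 f g p m') - (\<lambda>p. bilin Cmp2 f g p m')"
    "(\<lambda>p. bilin_diff f g m p) = (\<lambda>p. bilin Cmp1 f g m p) - (\<lambda>p. bilin Cmp2 f g m p)"
    by (simp_all add: bilin_diff_def fun_eq_iff minus_apply)
  show ?thesis
    unfolding e tlinearD(4)[OF lin] minus_apply[of _ _ m] minus_apply[of _ _ m']
    using bilin_odd_shifting[OF A, of Cmp1 f g m m'] bilin_odd_shifting[OF A, of Cmp2 f g m m']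
    by (simp only: bilin_diff_def) (simp add: algebra_simps)
qed

text \<open>The bilinear form vanishes on the image under \<open>exp (A z) \<otimes> exp (A z)\<close>; the logarithmic
  derivative in \<open>z\<close> reduces each coefficient to lower ones.\<close>

lemma bilin_diff_exp_modes:
  assumes U: "exp_modes A U" and A: "\<And>i. odd_shifting (A i)"
    and 0: "\<And>m m'. (\<Sum>x\<in>I. bilin_diff (F x) (G x) m m') = 0"
  shows "(\<Sum>x\<in>I. \<Sum>k\<in>{0..D}. bilin_diff (U k (F x)) (U (D - k) (G x)) m m') = 0"
proof (induction D arbitrary: m m' rule: int_measure_induct)
  case (nonpos D)
  then show ?case by (cases "D = 0") (simp_all add: exp_modesD(4)[OF U] 0)
next
  case (pos D)
  define N where "N = nat D"
  have N: "D \<le> int N" by (simp add: N_def)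
  let ?B = "\<lambda>f g. bilin_diff f g m m'"
  have neg: "U k f = 0" if "k < 0" for k f using that by (rule exp_modesD(3)[OF U])
  have A0: "tlinear (A i)" for i by (rule exp_modesD(1)[OF U])
  have "of_int D * (\<Sum>x\<in>I. \<Sum>k\<in>{0..D}. ?B (U k (F x)) (U (D - k) (G x)))
     = (\<Sum>x\<in>I. \<Sum>k\<in>{0..D}. ?B (scl (of_int k) (U k (F x))) (U (D - k) (G x))
          + ?B (U k (F x)) (scl (of_int (D - k)) (U (D - k) (G x))))"
    unfolding sum_distrib_left bilin_diff_scl_left bilin_diff_scl_right
    by (intro sum.cong refl) (simp add: algebra_simps)
  also have "\<dots> = (\<Sum>x\<in>I. \<Sum>k\<in>{0..D}. \<Sum>i<N. ?B (A i (U (k - odd_of i) (F x))) (U (D - k) (G x))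
          + ?B (U k (F x)) (A i (U (D - k - odd_of i) (G x))))"
  proof (intro sum.cong refl)
    fix x k assume "k \<in> {0..D}"
    then have k: "k \<le> int N" "D - k \<le> int N" using N by auto
    show "?B (scl (of_int k) (U k (F x))) (U (D - k) (G x)) + ?B (U k (F x)) (scl (of_int (D - k)) (U (D - k) (G x)))
       = (\<Sum>i<N. ?B (A i (U (k - odd_of i) (F x))) (U (D - k) (G x)) + ?B (U k (F x)) (A i (U (D - k - odd_of i) (G x))))"
      unfolding exp_modesD(5)[OF U k(1)] exp_modesD(5)[OF U k(2)]
      by (simp add: bilin_diff_sum_left bilin_diff_sum_right sum.distrib)
  qed
  also have "\<dots> = (\<Sum>x\<in>I. \<Sum>i<N. \<Sum>k\<in>{0..D}. ?B (A i (U (k - odd_of i) (F x))) (U (D - k) (G x))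
          + ?B (U k (F x)) (A i (U (D - k - odd_of i) (G x))))"
    by (intro sum.cong refl sum.swap)
  also have "\<dots> = (\<Sum>i<N. \<Sum>x\<in>I. \<Sum>k\<in>{0..D}. ?B (A i (U (k - odd_of i) (F x))) (U (D - k) (G x))
          + ?B (U k (F x)) (A i (U (D - k - odd_of i) (G x))))"
    by (rule sum.swap)
  also have "\<dots> = 0"
  proof (rule sum.neutral, rule ballI)
    fix i
    \<comment> \<open>With \<open>A i\<close> pulled out, both halves become the same sum at the
      lower level D', which vanishes at all monomials by induction.\<close>
    define D' where "D' = D - odd_of i"
    have D': "D' < D" using odd_of_pos[of i] by (simp add: D'_def)
    have 1: "(\<Sum>k\<in>{0..D}. ?B (A i (U (k - odd_of i) (F x))) (U (D - k) (G x))) =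
        (\<Sum>k\<in>{0..D'}. ?B (A i (U k (F x))) (U (D' - k) (G x)))" for x
    proof -
      have "(\<Sum>k\<in>{0..D}. ?B (A i (U (k - odd_of i) (F x))) (U (D - k) (G x))) =
        (\<Sum>k\<in>{0 - odd_of i..D'}. ?B (A i (U k (F x))) (U (D' - k) (G x)))"
        unfolding D'_def sum_int_shift[symmetric] by (simp add: algebra_simps)
      also have "\<dots> = (\<Sum>k\<in>{0..D'}. ?B (A i (U k (F x))) (U (D' - k) (G x)))"
        by (rule sum.mono_neutral_right)
           (use odd_of_pos[of i] in \<open>auto simp: neg tlinearD[OF A0] bilin_diff_zero_left\<close>)
      finally show ?thesis .
    qed
    have 2: "(\<Sum>k\<in>{0..D}. ?B (U k (F x)) (A i (U (D - k - odd_of i) (G x)))) =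
        (\<Sum>k\<in>{0..D'}. ?B (U k (F x)) (A i (U (D' - k) (G x))))" for x
    proof -
      have "(\<Sum>k\<in>{0..D}. ?B (U k (F x)) (A i (U (D - k - odd_of i) (G x)))) =
        (\<Sum>k\<in>{0..D}. ?B (U k (F x)) (A i (U (D' - k) (G x))))"
        by (simp add: D'_def algebra_simps)
      also have "\<dots> = (\<Sum>k\<in>{0..D'}. ?B (U k (F x)) (A i (U (D' - k) (G x))))"
        by (rule sum.mono_neutral_right)
           (use D' in \<open>auto simp: neg tlinearD[OF A0] bilin_diff_zero_right\<close>)
      finally show ?thesis .
    qed
    let ?S = "\<lambda>p p'. \<Sum>x\<in>I. \<Sum>k\<in>{0..D'}. bilin_diff (U k (F x)) (U (D' - k) (G x)) p p'"
    have "(\<Sum>x\<in>I. \<Sum>k\<in>{0..D}. ?B (A i (U (k - odd_of i) (F x))) (U (D - k) (G x))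
          + ?B (U k (F x)) (A i (U (D - k - odd_of i) (G x))))
      = (\<Sum>x\<in>I. \<Sum>k\<in>{0..D'}. A i (\<lambda>p. bilin_diff (U k (F x)) (U (D' - k) (G x)) p m') m
          + A i (\<lambda>p. bilin_diff (U k (F x)) (U (D' - k) (G x)) m p) m')"
      unfolding bilin_diff_odd_shifting[OF A, symmetric] sum.distrib 1 2 ..
    also have "\<dots> = A i (\<lambda>p. ?S p m') m + A i (\<lambda>p. ?S m p) m'"
    proof -
      have e: "(\<lambda>p. ?S p m') = (\<Sum>x\<in>I. \<Sum>k\<in>{0..D'}. (\<lambda>p. bilin_diff (U k (F x)) (U (D' - k) (G x)) p m'))"
        "(\<lambda>p. ?S m p) = (\<Sum>x\<in>I. \<Sum>k\<in>{0..D'}. (\<lambda>p. bilin_diff (U k (F x)) (U (D' - k) (G x)) m p))"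
        by (simp_all add: fun_eq_iff sum_fun_apply)
      show ?thesis unfolding e
        by (simp add: tlinearD[OF A0] sum_fun_apply sum.distrib)
    qed
    also have "(\<lambda>p. ?S p m') = 0" unfolding pos.IH[OF D'] by (simp add: zero_fun_def)
    also have "(\<lambda>p. ?S m p) = 0" unfolding pos.IH[OF D'] by (simp add: zero_fun_def)
    finally show "(\<Sum>x\<in>I. \<Sum>k\<in>{0..D}. ?B (A i (U (k - odd_of i) (F x))) (U (D - k) (G x))
          + ?B (U k (F x)) (A i (U (D - k - odd_of i) (G x)))) = 0"
      by (simp only: tlinearD(3)[OF A0] zero_fun_apply[of m] zero_fun_apply[of m'] add_0_left)
  qed
  finally show ?case using pos by simp
qed

text \<open>Multiplication by e^(xi(t^(a), u)) for an actual field element u; no convergence is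
  involved, as each coefficient is a finite sum.\<close>

definition exp_mult :: "comp \<Rightarrow> 'k::field_char_0 \<Rightarrow> 'k tser \<Rightarrow> 'k tser" where
  "exp_mult a u f = (\<lambda>m. \<Sum>k\<in>{0..int (wt m)}. u ^ nat k * exp_mode a k f m)"

lemma exp_mult_eq:
  assumes "L \<ge> int (wt m)"
  shows "exp_mult a u f m = (\<Sum>k\<in>{0..L}. scl (u ^ nat k) (exp_mode a k f)) m"
  unfolding exp_mult_def sum_fun_apply scl_apply
  by (rule sum.mono_neutral_left) (use assms in \<open>auto simp: exp_mode_eq_0\<close>)

lemma bilin_diff_local:
  assumes "\<And>p. wt p \<le> wt m + wt m' \<Longrightarrow> f p = f' p" "\<And>p. wt p \<le> wt m + wt m' \<Longrightarrow> g p = g' p"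
  shows "bilin_diff f g m m' = bilin_diff f' g' m m'"
  unfolding bilin_diff_def by (intro arg_cong2[where f=minus] bilin_local assms)

lemma bilin_diff_exp_mult:
  assumes 0: "\<And>m m'. bilin_diff f g m m' = 0"
  shows "bilin_diff (exp_mult a u f) (exp_mult a u g) m m' = 0"
proof -
  define W where "W = int (wt m) + int (wt m')"
  let ?E = "exp_mode a"
  let ?T = "\<lambda>k k'. u ^ (nat k + nat k') * bilin_diff (?E k f) (?E k' g) m m'"
  have big: "?T k k' = 0" if "k > W \<or> k' > W" for k k'
  proof -
    have "bilin_diff (?E k f) (?E k' g) m m' = bilin_diff 0 (?E k' g) m m'" if "k > W"
      by (rule bilin_diff_local) (use that in \<open>auto simp: W_def exp_mode_eq_0 zero_fun_apply\<close>)
    moreover have "bilin_diff (?E k f) (?E k' g) m m' = bilin_diff (?E k f) 0 m m'" if "k' > W"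
      by (rule bilin_diff_local) (use that in \<open>auto simp: W_def exp_mode_eq_0 zero_fun_apply\<close>)
    ultimately show ?thesis using that by (auto simp: bilin_diff_zero_left bilin_diff_zero_right)
  qed
  have "bilin_diff (exp_mult a u f) (exp_mult a u g) m m' =
    bilin_diff (\<Sum>k\<in>{0..W}. scl (u ^ nat k) (?E k f)) (\<Sum>k\<in>{0..W}. scl (u ^ nat k) (?E k g)) m m'"
    by (rule bilin_diff_local; rule exp_mult_eq) (auto simp: W_def)
  also have "\<dots> = (\<Sum>k\<in>{0..W}. \<Sum>k'\<in>{0..W}. ?T k k')"
    by (simp only: bilin_diff_sum_left bilin_diff_scl_left,
        simp only: bilin_diff_sum_right bilin_diff_scl_right power_add sum_distrib_left mult.assoc)
  also have "\<dots> = (\<Sum>(k, k')\<in>{0..W} \<times> {0..W}. ?T k k')"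
    by (rule sum.cartesian_product)
  \<comment> \<open>Grouping by the total power D of u. The square is enlarged to a triangle of side
    2W, and the added terms vanish at these monomials.\<close>
  also have "\<dots> = (\<Sum>(D, k)\<in>Sigma {0..2 * W} (\<lambda>D. {0..D}). ?T k (D - k))"
  proof -
    let ?Q = "{0..W} \<times> {0..W}"
    let ?h = "\<lambda>(D, k). (k, D - k) :: int \<times> int"
    let ?S = "Sigma {0..2 * W} (\<lambda>D. {0..D})"
    have inj: "inj_on ?h ?S" by (auto simp: inj_on_def)
    have "(\<Sum>(D, k)\<in>?S. ?T k (D - k)) = (\<Sum>(k, k')\<in>?h ` ?S. ?T k k')"
      unfolding sum.reindex[OF inj] by (simp add: split_def o_def)
    also have "\<dots> = (\<Sum>(k, k')\<in>?Q. ?T k k')"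
    proof (rule sum.mono_neutral_right)
      show "finite (?h ` ?S)" by auto
      show "?Q \<subseteq> ?h ` ?S"
      proof
        fix x assume "x \<in> ?Q"
        then show "x \<in> ?h ` ?S"
          by (intro image_eqI[of _ _ "(fst x + snd x, fst x)"]) auto
      qed
      show "\<forall>x\<in>?h ` ?S - ?Q. (case x of (k, k') \<Rightarrow> ?T k k') = 0"
      proof
        fix x assume x: "x \<in> ?h ` ?S - ?Q"
        then have "fst x > W \<or> snd x > W" by (cases x) auto
        then show "(case x of (k, k') \<Rightarrow> ?T k k') = 0" using big by (cases x) auto
      qed
    qed
    finally show ?thesis by simp
  qed
  also have "\<dots> = (\<Sum>D\<in>{0..2 * W}. \<Sum>k\<in>{0..D}. ?T k (D - k))"
    by (rule sum.Sigma[symmetric]) auto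
  also have "\<dots> = (\<Sum>D\<in>{0..2 * W}. u ^ nat D * (\<Sum>k\<in>{0..D}. bilin_diff (?E k f) (?E (D - k) g) m m'))"
    unfolding sum_distrib_left
    by (intro sum.cong refl) (auto simp flip: nat_add_distrib)
  also have "\<dots> = 0"
    using bilin_diff_exp_modes[OF exp_modes_exp[of a] odd_shifting_tmult, where I="{()}" and F="\<lambda>_. f" and G="\<lambda>_. g"] 0
    by simp
  finally show ?thesis .
qed

subsection \<open>Coefficients in the two parameters\<close>

text \<open>Extracting a Laurent coefficient is additive but not multiplicative. In characteristic 0
  additivity gives compatibility with rational factors, which is all that the modes involve.\<close>

lemma additive_of_int_mult:
  assumes "additive \<kappa>"
  shows "\<kappa> (of_int n * x :: 'k::ring_1) = of_int n * (\<kappa> x :: 'l::ring_1)"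
proof -
  interpret additive \<kappa> by fact
  have nat: "\<kappa> (of_nat n * x) = of_nat n * \<kappa> x" for n
    by (induction n) (simp_all add: zero add algebra_simps)
  show ?thesis
    using nat by (cases n rule: int_cases2) (simp_all add: minus)
qed

lemma additive_divide_of_nat:
  fixes x :: "'k::field_char_0" and \<kappa> :: "'k \<Rightarrow> 'l::field_char_0"
  assumes "additive \<kappa>"
  shows "\<kappa> (x / of_nat n) = \<kappa> x / of_nat n"
proof (cases "n = 0")
  case True
  then show ?thesis using additive.zero[OF assms] by simp
next
  case False
  then have "of_int (int n) * \<kappa> (x / of_nat n) = \<kappa> x"
    by (subst additive_of_int_mult[OF assms, symmetric]) simp
  then show ?thesis using False by (simp add: field_simps)
qed

text \<open>The recursion for k times the mode has integer coefficients, so the induction avoids the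
  explicit binomial weights.\<close>

lemma additive_shift_mode:
  fixes \<kappa> :: "'k::field_char_0 \<Rightarrow> 'l::field_char_0"
  assumes "additive \<kappa>"
  shows "\<kappa> (shift_mode (of_int s) a k f m) = shift_mode (of_int s) a k (\<lambda>p. \<kappa> (f p)) m"
proof (induction k arbitrary: m rule: int_measure_induct)
  case (nonpos k)
  then show ?case
    by (cases "k = 0") (simp_all add: shift_mode_neg zero_fun_apply additive.zero[OF assms])
next
  case (pos k)
  define N where "N = nat k"
  have N: "k \<le> int N" by (simp add: N_def)
  let ?u = "\<lambda>i. Poly_Mapping.single (a, i) 1 :: mono"
  have eq: "of_int k * shift_mode (of_int s) a k f m = (\<Sum>i<N. of_int (s * int (Poly_Mapping.lookup m (a, i) + 1))
      * shift_mode (of_int s) a (k - odd_of i) f (m + ?u i))" for f :: "'b::field_char_0 tser"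
    using fun_cong[OF shift_mode_Euler[OF N, of "of_int s" a f], of m]
    by (simp add: scl_apply sum_fun_apply tderiv_def mult.assoc)
  have "of_int k * \<kappa> (shift_mode (of_int s) a k f m) = \<kappa> (of_int k * shift_mode (of_int s) a k f m)"
    by (rule additive_of_int_mult[OF assms, symmetric])
  also have "\<dots> = (\<Sum>i<N. of_int (s * int (Poly_Mapping.lookup m (a, i) + 1))
      * \<kappa> (shift_mode (of_int s) a (k - odd_of i) f (m + ?u i)))"
    unfolding eq additive.sum[OF assms] additive_of_int_mult[OF assms] ..
  also have "\<dots> = (\<Sum>i<N. of_int (s * int (Poly_Mapping.lookup m (a, i) + 1))
      * shift_mode (of_int s) a (k - odd_of i) (\<lambda>p. \<kappa> (f p)) (m + ?u i))"
    by (intro sum.cong refl arg_cong2[where f=times] pos.IH) (use odd_of_pos in auto)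
  also have "\<dots> = of_int k * shift_mode (of_int s) a k (\<lambda>p. \<kappa> (f p)) m"
    unfolding eq ..
  finally show ?case using pos by simp
qed

lemma additive_exp_mode:
  fixes \<kappa> :: "'k::field_char_0 \<Rightarrow> 'l::field_char_0"
  assumes "additive \<kappa>"
  shows "\<kappa> (exp_mode a k f m) = exp_mode a k (\<lambda>p. \<kappa> (f p)) m"
  unfolding exp_mode_def additive.sum[OF assms]
  by (intro sum.cong refl) (auto simp: additive_divide_of_nat[OF assms] additive.zero[OF assms])

lemma additive_vertex_mode:
  fixes \<kappa> :: "'k::field_char_0 \<Rightarrow> 'l::field_char_0"
  assumes "additive \<kappa>"
  shows "\<kappa> (vertex_mode a n f m) = vertex_mode a n (\<lambda>p. \<kappa> (f p)) m"
  unfolding vertex_mode_def additive.sum[OF assms] additive_exp_mode[OF assms]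
  using additive_shift_mode[OF assms, of "- 2"] by simp

lemma additive_sg_mult:
  fixes \<kappa> :: "'k::field_char_0 \<Rightarrow> 'l::field_char_0"
  assumes "additive \<kappa>"
  shows "\<kappa> (sg n * x) = sg n * \<kappa> x"
  using additive.minus[OF assms] by (simp add: sg_def)

section \<open>Laurent coefficients in the parameter field\<close>

definition K_coeff :: "int \<Rightarrow> int \<Rightarrow> K \<Rightarrow> complex" where
  "K_coeff i j x = fls_nth (fls_nth x (- i)) (- j)"

lemma additive_K_coeff: "additive (K_coeff i j)"
  by standard (simp add: K_coeff_def)

lemmas K_coeff_add = additive.add[OF additive_K_coeff]
  and K_coeff_diff = additive.diff[OF additive_K_coeff]
  and K_coeff_sum = additive.sum[OF additive_K_coeff]
  and K_coeff_0 = additive.zero[OF additive_K_coeff]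

lemma K_eqI: "(\<And>i j. K_coeff i j x = K_coeff i j y) \<Longrightarrow> x = y"
  by (intro fls_eqI) (metis K_coeff_def minus_minus)

lemma K_coeff_cK_mult: "K_coeff i j (cK c * x) = c * K_coeff i j x"
  by (simp add: K_coeff_def cK_def fls_mult_const_nth)

lemma K_coeff_mu_mult: "K_coeff i j (mu * x) = K_coeff (i - 1) j x"
  by (simp add: K_coeff_def mu_def fls_X_inv_times_conv_shift)

lemma K_coeff_lam_mult: "K_coeff i j (lam * x) = K_coeff i (j - 1) x"
  by (simp add: K_coeff_def lam_def fls_mult_const_nth fls_X_inv_times_conv_shift)

lemma K_coeff_mu_power_mult: "K_coeff i j (mu ^ n * x) = K_coeff (i - int n) j x"
  by (induction n arbitrary: i) (simp_all add: mult.assoc K_coeff_mu_mult algebra_simps)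

lemma K_coeff_lam_power_mult: "K_coeff i j ((- lam) ^ n * x) = sg (int n) * K_coeff i (j - int n) x"
proof (induction n arbitrary: j)
  case (Suc n)
  have "K_coeff i j ((- lam) ^ Suc n * x) = - K_coeff i j (lam * ((- lam) ^ n * x))"
    using additive.minus[OF additive_K_coeff, of i j "lam * ((- lam) ^ n * x)"] by (simp add: mult.assoc)
  also have "\<dots> = - (sg (int n) * K_coeff i (j - 1 - int n) x)"
    by (simp only: K_coeff_lam_mult Suc)
  also have "\<dots> = sg (int (Suc n)) * K_coeff i (j - int (Suc n)) x"
    by (simp add: sg_def algebra_simps)
  finally show ?case .
qed (simp add: sg_def)

text \<open>Since mu^(-1) is the outer variable, powers of mu are bounded above uniformly in lambda.
  This fixes the direction in which \<open>eps\<close> is expanded.\<close>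

lemma K_coeff_bounded: "\<exists>B. \<forall>i>B. \<forall>j. K_coeff i j x = 0"
  by (intro exI[of _ "- fls_subdegree x"]) (auto simp: K_coeff_def)

lemma additive_cK: "additive cK"
  by standard (simp add: cK_def flip: fls_plus_const)

lemma cK_mult: "cK (x * y) = cK x * cK y"
  by (simp add: cK_def)

lemma bilin_cK: "bilin c (\<lambda>p. cK (f p)) (\<lambda>p. cK (g p)) m m' = cK (bilin c f g m m')"
  unfolding bilin_def additive.sum[OF additive_cK] mult.assoc additive_sg_mult[OF additive_cK]
  unfolding cK_mult additive_vertex_mode[OF additive_cK] ..

lemma K_coeff_bilin_cK:
  "K_coeff i j (bilin c (\<lambda>p. cK (f p)) g m m') = bilin c f (\<lambda>p. K_coeff i j (g p)) m m'"
  unfolding bilin_def K_coeff_sum mult.assoc additive_sg_mult[OF additive_K_coeff]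
    additive_vertex_mode[OF additive_cK, symmetric] K_coeff_cK_mult additive_vertex_mode[OF additive_K_coeff] ..

lemma fls_regular_times_nth:
  fixes f g :: "'a::comm_ring_1 fls"
  assumes "\<And>n. n < 0 \<Longrightarrow> fls_nth f n = 0" "\<And>n. n < 0 \<Longrightarrow> fls_nth g n = 0"
  shows "fls_nth (f * g) N = (\<Sum>l\<in>{0..N}. fls_nth f l * fls_nth g (N - l))"
proof -
  define F where "F = Abs_fps (\<lambda>n. fls_nth f (int n))"
  define G where "G = Abs_fps (\<lambda>n. fls_nth g (int n))"
  have fg: "f = fps_to_fls F" "g = fps_to_fls G"
    using assms by (auto simp: F_def G_def intro!: fls_eqI)
  show ?thesis
  proof (cases "N < 0")
    case True
    then show ?thesis by (simp add: fg flip: fls_times_fps_to_fls)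
  next
    case False
    then have "fls_nth (f * g) N = (\<Sum>l\<in>{0..nat N}. fps_nth F l * fps_nth G (nat N - l))"
      by (simp add: fg fps_mult_nth flip: fls_times_fps_to_fls)
    also have "\<dots> = (\<Sum>l\<in>{0..N}. fls_nth f l * fls_nth g (N - l))"
      by (rule sum.reindex_bij_witness[of _ nat int])
         (use False in \<open>auto simp: F_def G_def of_nat_diff\<close>)
    finally show ?thesis .
  qed
qed

lemma K_coeff_regular_times:
  assumes "\<And>i j. i > 0 \<or> j > 0 \<Longrightarrow> K_coeff i j x = 0" "\<And>i j. i > 0 \<or> j > 0 \<Longrightarrow> K_coeff i j y = 0"
  shows "K_coeff (- L) (- J) (x * y) =
    (\<Sum>l\<in>{0..L}. \<Sum>k\<in>{0..J}. K_coeff (- l) (- k) x * K_coeff (- (L - l)) (- (J - k)) y)"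
proof -
  have inner: "fls_nth (fls_nth z n) k = 0" if "\<And>i j. i > 0 \<or> j > 0 \<Longrightarrow> K_coeff i j z = 0" "n < 0 \<or> k < 0"
    for z n k
    using that(1)[of "- n" "- k"] that(2) by (simp add: K_coeff_def)
  have outer: "fls_nth z n = 0" if "\<And>i j. i > 0 \<or> j > 0 \<Longrightarrow> K_coeff i j z = 0" "n < 0" for z n
    by (intro fls_eqI) (use inner[OF that(1)] that(2) in auto)
  have "fls_nth (x * y) L = (\<Sum>l\<in>{0..L}. fls_nth x l * fls_nth y (L - l))"
    by (rule fls_regular_times_nth) (use outer assms in blast)+
  then have "K_coeff (- L) (- J) (x * y) = (\<Sum>l\<in>{0..L}. fls_nth (fls_nth x l * fls_nth y (L - l)) J)"
    by (simp add: K_coeff_def fls_nth_sum)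
  also have "\<dots> = (\<Sum>l\<in>{0..L}. \<Sum>k\<in>{0..J}. fls_nth (fls_nth x l) k * fls_nth (fls_nth y (L - l)) (J - k))"
    by (intro sum.cong refl fls_regular_times_nth) (use inner assms in blast)+
  finally show ?thesis by (simp add: K_coeff_def)
qed

lemma K_coeff_Shml:
  "K_coeff i j (Shml a b f m) = shift_mode (- 2) a (- i) (shift_mode 2 b (- j) f) m"
proof (cases "i > 0 \<or> j > 0")
  case True
  then have "shift_mode (- 2) a (- i) (shift_mode 2 b (- j) f) = 0"
    by (auto simp: shift_mode_neg tlinearD[OF tlinear_shift_mode])
  then show ?thesis using True by (auto simp: K_coeff_def Shml_def zero_fun_apply)
next
  case False
  then show ?thesis by (simp add: K_coeff_def Shml_def shift_mode_def)
qed

text \<open>Translated series contain only nonpositive powers of both parameters and modes preserve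
  this, so the coefficients of a product are finite Cauchy sums.\<close>

lemma K_coeff_bilin_Shml:
  "K_coeff (- L) (- J) (bilin c (Shml a b f) (Shml a b f) m m') =
    (\<Sum>l\<in>{0..L}. \<Sum>k\<in>{0..J}. bilin c (shift_mode (- 2) a l (shift_mode 2 b k f))
       (shift_mode (- 2) a (L - l) (shift_mode 2 b (J - k) f)) m m')"
proof -
  let ?G = "Shml a b f" and ?R = "{- int (wt m')..int (wt m)}"
  let ?S = "\<lambda>l k. shift_mode (- 2) a l (shift_mode 2 b k f)"
  have V: "K_coeff i j (vertex_mode c n ?G p) = vertex_mode c n (?S (- i) (- j)) p" for i j n p
    unfolding additive_vertex_mode[OF additive_K_coeff] K_coeff_Shml ..
  have reg: "K_coeff i j (vertex_mode c n ?G p) = 0" if "i > 0 \<or> j > 0" for i j n p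
  proof -
    have "?S (- i) (- j) = 0" using that by (auto simp: shift_mode_neg tlinearD[OF tlinear_shift_mode])
    then show ?thesis unfolding V by (simp add: tlinearD[OF tlinear_vertex_mode] zero_fun_apply)
  qed
  have "K_coeff (- L) (- J) (bilin c ?G ?G m m') =
    (\<Sum>n\<in>?R. sg n * K_coeff (- L) (- J) (vertex_mode c n ?G m * vertex_mode c (- n) ?G m'))"
    unfolding bilin_def K_coeff_sum mult.assoc additive_sg_mult[OF additive_K_coeff] ..
  also have "\<dots> = (\<Sum>n\<in>?R. sg n * (\<Sum>l\<in>{0..L}. \<Sum>k\<in>{0..J}.
      vertex_mode c n (?S l k) m * vertex_mode c (- n) (?S (L - l) (J - k)) m'))"
    by (simp add: K_coeff_regular_times[OF reg reg] V)
  also have "\<dots> = (\<Sum>n\<in>?R. \<Sum>l\<in>{0..L}. \<Sum>k\<in>{0..J}.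
      sg n * vertex_mode c n (?S l k) m * vertex_mode c (- n) (?S (L - l) (J - k)) m')"
    by (simp add: sum_distrib_left mult.assoc)
  also have "\<dots> = (\<Sum>l\<in>{0..L}. \<Sum>n\<in>?R. \<Sum>k\<in>{0..J}.
      sg n * vertex_mode c n (?S l k) m * vertex_mode c (- n) (?S (L - l) (J - k)) m')"
    by (rule sum.swap)
  also have "\<dots> = (\<Sum>l\<in>{0..L}. \<Sum>k\<in>{0..J}. \<Sum>n\<in>?R.
      sg n * vertex_mode c n (?S l k) m * vertex_mode c (- n) (?S (L - l) (J - k)) m')"
    by (intro sum.cong refl sum.swap)
  finally show ?thesis by (simp only: bilin_def)
qed

text \<open>\<open>bilin_diff_exp_modes\<close> is used twice: for the translation in lambda with a
  single pair, then for the one in mu with the family of pairs indexed by the power of lambda. The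
  second use is why it is stated for sums of pairs.\<close>

lemma bilin_diff_Shml:
  assumes "\<And>m m'. bilin_diff f f m m' = 0"
  shows "bilin_diff (Shml a b f) (Shml a b f) m m' = 0"
proof (rule K_eqI)
  fix i j
  let ?S = "shift_mode 2 b" and ?T = "shift_mode (- 2) a"
  have 1: "(\<Sum>k\<in>{0..- j}. bilin_diff (?S k f) (?S (- j - k) f) m m') = 0" for m m'
    using bilin_diff_exp_modes[OF exp_modes_shift[of 2 b] odd_shifting_tderiv,
        where I="{()}" and F="\<lambda>_. f" and G="\<lambda>_. f"] assms
    by simp
  have "K_coeff i j (bilin_diff (Shml a b f) (Shml a b f) m m') =
     (\<Sum>l\<in>{0..- i}. \<Sum>k\<in>{0..- j}. bilin_diff (?T l (?S k f)) (?T (- i - l) (?S (- j - k) f)) m m')"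
    unfolding bilin_diff_def K_coeff_diff
    using K_coeff_bilin_Shml[of "- i" "- j" _ a b f m m'] by (simp add: sum_subtractf)
  also have "\<dots> = (\<Sum>k\<in>{0..- j}. \<Sum>l\<in>{0..- i}. bilin_diff (?T l (?S k f)) (?T (- i - l) (?S (- j - k) f)) m m')"
    by (rule sum.swap)
  also have "\<dots> = 0"
    by (rule bilin_diff_exp_modes[OF exp_modes_shift odd_shifting_tderiv]) (rule 1)
  finally show "K_coeff i j (bilin_diff (Shml a b f) (Shml a b f) m m') = K_coeff i j 0"
    by (simp add: K_coeff_0)
qed

section \<open>Factorisation and coefficients of X_ab\<close>

lemma exp_mult_splittings:
  "exp_mult a u f m = (\<Sum>(p, q)\<in>{(p, q). p + q = m}.
     if on_comp a q then u ^ wt q * f p / of_nat (mfact q) else 0)"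
proof -
  have "exp_mult a u f m = (\<Sum>k\<in>{0..int (wt m)}. \<Sum>x\<in>{(p, q). p + q = m}.
     if on_comp a (snd x) \<and> int (wt (snd x)) = k then u ^ nat k * f (fst x) / of_nat (mfact (snd x)) else 0)"
    unfolding exp_mult_def exp_mode_splittings split_def sum_distrib_left
    by (intro sum.cong refl) auto
  also have "\<dots> = (\<Sum>x\<in>{(p, q). p + q = m}. \<Sum>k\<in>{0..int (wt m)}.
     if on_comp a (snd x) \<and> int (wt (snd x)) = k then u ^ nat k * f (fst x) / of_nat (mfact (snd x)) else 0)"
    by (rule sum.swap)
  also have "\<dots> = (\<Sum>x\<in>{(p, q). p + q = m}.
     if on_comp a (snd x) then u ^ wt (snd x) * f (fst x) / of_nat (mfact (snd x)) else 0)"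
  proof (rule sum.cong[OF refl])
    fix x assume "x \<in> {(p, q). p + q = m}"
    then have wt: "wt (snd x) \<le> wt m" by auto
    let ?t = "\<lambda>k. u ^ nat k * f (fst x) / of_nat (mfact (snd x))"
    have "(\<Sum>k\<in>{0..int (wt m)}. if on_comp a (snd x) \<and> int (wt (snd x)) = k then ?t k else 0)
      = (\<Sum>k\<in>{0..int (wt m)}. if k = int (wt (snd x)) then if on_comp a (snd x) then ?t k else 0 else 0)"
      by (intro sum.cong) auto
    also have "\<dots> = (if on_comp a (snd x) then ?t (int (wt (snd x))) else 0)"
      using wt by (auto simp: sum.delta)
    finally show "(\<Sum>k\<in>{0..int (wt m)}. if on_comp a (snd x) \<and> int (wt (snd x)) = k then ?t k else 0)
      = (if on_comp a (snd x) then u ^ wt (snd x) * f (fst x) / of_nat (mfact (snd x)) else 0)" by simp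
  qed
  finally show ?thesis by (simp add: split_def)
qed

text \<open>Only odd times occur, so -xi(t^(b), lambda) = xi(t^(b), -lambda) and both exponential
  factors are of the same kind.\<close>

lemma Xop_eq_exp_mult:
  "Xop a b f = scl (eps a b) (exp_mult a mu (exp_mult b (- lam) (Shml a b f)))"
proof
  fix m
  let ?G = "Shml a b f"
  let ?P = "\<lambda>m. {x. fst x + snd x = (m :: mono)}"
  let ?t = "\<lambda>p q1 q2. if on_comp a q1 \<and> on_comp b q2
      then mu ^ wt q1 * ((- lam) ^ wt q2 * ?G p) / (of_nat (mfact q1) * of_nat (mfact q2)) else 0"
  have P: "finite (?P m)" for m using finite_splittings[of m] by (simp add: split_def)
  have "(\<Sum>x\<in>?P m. Eml a b (snd x) * ?G (fst x)) = (\<Sum>x\<in>?P m. \<Sum>y\<in>?P (snd x). ?t (fst x) (fst y) (snd y))"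
    unfolding Eml_def split_def sum_distrib_right
    by (intro sum.cong refl) (simp add: minus_one_power_deg power_minus[of lam])
  also have "\<dots> = (\<Sum>(x, y)\<in>Sigma (?P m) (\<lambda>x. ?P (snd x)). ?t (fst x) (fst y) (snd y))"
    by (rule sum.Sigma) (use P in auto)
  \<comment> \<open>Regroups m = p + (q1 + q2) as (p + q2) + q1.\<close>
  also have "\<dots> = (\<Sum>(x, y)\<in>Sigma (?P m) (\<lambda>x. ?P (fst x)). ?t (fst y) (snd x) (snd y))"
    by (rule sum.reindex_bij_witness[of _ "\<lambda>(x, y). ((fst y, snd x + snd y), (snd x, snd y))"
          "\<lambda>(x, y). ((fst x + snd y, fst y), (fst x, snd y))"]) (auto simp: add_ac)
  also have "\<dots> = (\<Sum>x\<in>?P m. \<Sum>y\<in>?P (fst x). ?t (fst y) (snd x) (snd y))"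
    by (rule sum.Sigma[symmetric]) (use P in auto)
  also have "\<dots> = exp_mult a mu (exp_mult b (- lam) ?G) m"
    unfolding exp_mult_splittings split_def
    by (intro sum.cong refl) (auto simp: sum_distrib_left sum_divide_distrib intro!: sum.cong)
  finally show "Xop a b f m = scl (eps a b) (exp_mult a mu (exp_mult b (- lam) ?G)) m"
    by (simp add: Xop_def split_def scl_apply)
qed

lemma shift_mode_2:
  fixes f :: "'a::field_char_0 tser"
  shows "shift_mode 2 a k f = scl (sg k) (shift_mode (- 2) a k f)"
proof (cases "k < 0")
  case True
  then show ?thesis by (simp add: shift_mode_neg)
next
  case False
  then have "(-1) ^ nat k = (sg k :: 'a)" by (simp flip: sg_of_nat)
  then show ?thesis using shift_mode_uminus[of "- 2" a k f] by simp
qed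

text \<open>The sign comes from evaluating X_b at -lambda: the exponential mode of index k' gives
  (-1)^k', the matching translation (-1)^(k'-j), together (-1)^j.\<close>

lemma K_coeff_exp_mult:
  "K_coeff i j (exp_mult a mu (exp_mult b (- lam) (Shml a b f)) m) = sg j * normal_mode a b i j f m"
proof -
  define W where "W = int (wt m)"
  let ?G = "Shml a b f" and ?E = exp_mode
  let ?T = "shift_mode (- 2)"
  have "exp_mult a mu (exp_mult b (- lam) ?G) m = (\<Sum>k\<in>{0..W}. mu ^ nat k * ?E a k (exp_mult b (- lam) ?G) m)"
    by (simp add: exp_mult_def W_def)
  also have "\<dots> = (\<Sum>k\<in>{0..W}. mu ^ nat k * ?E a k (\<Sum>k'\<in>{0..W}. scl ((- lam) ^ nat k') (?E b k' ?G)) m)"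
    by (intro sum.cong refl arg_cong2[where f=times] exp_mode_local exp_mult_eq) (auto simp: W_def)
  also have "\<dots> = (\<Sum>k\<in>{0..W}. \<Sum>k'\<in>{0..W}. mu ^ nat k * ((- lam) ^ nat k' * ?E a k (?E b k' ?G) m))"
    by (simp add: tlinearD[OF tlinear_exp_mode] sum_fun_apply scl_apply sum_distrib_left)
  finally have "K_coeff i j (exp_mult a mu (exp_mult b (- lam) ?G) m) =
     (\<Sum>k\<in>{0..W}. \<Sum>k'\<in>{0..W}. sg (int (nat k')) * K_coeff (i - int (nat k)) (j - int (nat k')) (?E a k (?E b k' ?G) m))"
    by (simp add: K_coeff_sum K_coeff_mu_power_mult K_coeff_lam_power_mult)
  also have "\<dots> = (\<Sum>k\<in>{0..W}. \<Sum>k'\<in>{0..W}. sg j * ?E a k (?E b k' (?T a (k - i) (?T b (k' - j) f))) m)"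
  proof (intro sum.cong refl)
    fix k k' assume k: "k \<in> {0..W}" "k' \<in> {0..W}"
    have sg: "sg k' * sg (k' - j) = (sg j :: complex)" by (auto simp: sg_def)
    have "K_coeff (i - k) (j - k') (?E a k (?E b k' ?G) m)
        = ?E a k (?E b k' (?T a (k - i) (shift_mode 2 b (k' - j) f))) m"
      by (simp add: additive_exp_mode[OF additive_K_coeff] K_coeff_Shml)
    also have "\<dots> = sg (k' - j) * ?E a k (?E b k' (?T a (k - i) (?T b (k' - j) f))) m"
      unfolding shift_mode_2[of b] by (simp add: tlinearD[OF tlinear_exp_mode] tlinearD[OF tlinear_shift_mode] scl_apply)
    finally show "sg (int (nat k')) * K_coeff (i - int (nat k)) (j - int (nat k')) (?E a k (?E b k' ?G) m)
      = sg j * ?E a k (?E b k' (?T a (k - i) (?T b (k' - j) f))) m"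
      using k sg by (simp flip: mult.assoc)
  qed
  also have "\<dots> = sg j * (\<Sum>k\<in>{0..W}. \<Sum>k'\<in>{0..W}. ?E a k (?E b k' (?T a (k - i) (?T b (k' - j) f))) m)"
    by (simp add: sum_distrib_left)
  also have "(\<Sum>k\<in>{0..W}. \<Sum>k'\<in>{0..W}. ?E a k (?E b k' (?T a (k - i) (?T b (k' - j) f))) m)
     = normal_mode a b i j f m"
  proof -
    let ?F = "\<lambda>l k. ?E a (i + l) (?E b (j + k) (?T a l (?T b k f))) m"
    have "(\<Sum>k\<in>{0..W}. \<Sum>k'\<in>{0..W}. ?E a k (?E b k' (?T a (k - i) (?T b (k' - j) f))) m)
       = (\<Sum>k\<in>{0..W}. \<Sum>k'\<in>{0..W}. ?F (k - i) (k' - j))" by simp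
    also have "\<dots> = (\<Sum>l\<in>{0 - i..W - i}. \<Sum>k\<in>{0 - j..W - j}. ?F l k)"
      unfolding sum_int_shift[where c=i, symmetric] sum_int_shift[where c=j, symmetric] ..
    also have "\<dots> = (\<Sum>l\<in>{0 - i..W - i}. \<Sum>k\<in>{- \<bar>j\<bar>..W - j}. ?F l k)"
      by (intro sum.cong refl sum.mono_neutral_left)
         (auto simp: exp_mode_neg tlinearD[OF tlinear_exp_mode] zero_fun_apply)
    also have "\<dots> = (\<Sum>l\<in>{- \<bar>i\<bar>..W - i}. \<Sum>k\<in>{- \<bar>j\<bar>..W - j}. ?F l k)"
      by (intro sum.mono_neutral_left)
         (auto simp: exp_mode_neg zero_fun_apply intro!: sum.neutral)
    also have "\<dots> = normal_mode a b i j f m"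
      by (subst normal_mode_eq[of "- \<bar>i\<bar>" m i "W - i" "- \<bar>j\<bar>" j "W - j"]) (auto simp: W_def sum_fun_apply)
    finally show ?thesis .
  qed
  finally show ?thesis .
qed

lemma mu_neq_lam: "mu \<noteq> lam"
proof
  assume "mu = lam"
  then have "K_coeff 1 0 (mu * 1) = K_coeff 1 0 (lam * 1)" by simp
  then show False unfolding K_coeff_mu_mult K_coeff_lam_mult by (simp add: K_coeff_def)
qed

text \<open>For a = b, multiplying by mu - lambda shows that both sides obey the same recursion, so
  their difference is constant along each line i + j = const. For large i both vanish: powers of mu
  are bounded above in \<open>K\<close>, and phi_i vanishes at \<open>m\<close> once i exceeds its
  weight.\<close>

lemma K_coeff_Xop:
  "K_coeff i j (Xop a b f m) = sg j * vertex_mode a i (vertex_mode b j f) m"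
proof (cases "a = b")
  case False
  then show ?thesis
    by (simp add: Xop_eq_exp_mult eps_def K_coeff_exp_mult vertex_mode_vertex_mode_diff)
next
  case True
  let ?Y = "exp_mult a mu (exp_mult a (- lam) (Shml a a f)) m"
  define w where "w i j = K_coeff i j (Xop a a f m)" for i j
  define z where "z i j = sg j * vertex_mode a i (vertex_mode a j f) m" for i j
  have "(mu - lam) * Xop a a f m = (mu + lam) * ?Y"
    using mu_neq_lam by (simp add: Xop_eq_exp_mult scl_apply eps_def)
  then have "K_coeff i j (mu * Xop a a f m - lam * Xop a a f m) = K_coeff i j (mu * ?Y + lam * ?Y)" for i j
    by (simp only: left_diff_distrib distrib_right)
  then have w: "w (i - 1) j - w i (j - 1) = sg j * (normal_mode a a (i - 1) j f m - normal_mode a a i (j - 1) f m)" for i j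
    unfolding K_coeff_diff K_coeff_add K_coeff_mu_mult K_coeff_lam_mult K_coeff_exp_mult
    by (auto simp: w_def sg_def algebra_simps)
  have z: "z (i - 1) j - z i (j - 1) = sg j * (normal_mode a a (i - 1) j f m - normal_mode a a i (j - 1) f m)" for i j
    using fun_cong[OF vertex_mode_normal_mode[of a i j f], of m]
    by (auto simp: z_def sg_def algebra_simps plus_fun_apply minus_apply)
  have "w (i - 1) j - z (i - 1) j = w i (j - 1) - z i (j - 1)" for i j
    using w[of i j] z[of i j] by algebra
  note wz = this
  have step: "w i j - z i j = w (i + int x) (j - int x) - z (i + int x) (j - int x)" for x
  proof (induction x)
    case (Suc x)
    have e: "i + int (Suc x) = i + int x + 1" "j - int (Suc x) = j - int x - 1" by simp_all
    show ?case unfolding e Suc using wz[of "i + int x + 1" "j - int x"] by simp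
  qed simp
  obtain B where B: "\<And>i j. i > B \<Longrightarrow> w i j = 0"
    unfolding w_def using K_coeff_bounded by blast
  define x where "x = nat (max B (int (wt m)) + 1 - i)"
  have "i + int x > B" "i + int x > int (wt m)" by (auto simp: x_def)
  then have "w i j - z i j = 0"
    unfolding step[of x] by (simp add: B z_def vertex_mode_eq_0)
  then show ?thesis using True by (simp add: w_def z_def)
qed

section \<open>Quadratic and mixed terms\<close>

lemma bilin_diff_Xop:
  assumes "\<And>m m'. bilin_diff f f m m' = 0"
  shows "bilin_diff (Xop a b f) (Xop a b f) m m' = 0"
  unfolding Xop_eq_exp_mult bilin_diff_scl_left bilin_diff_scl_right
  by (simp add: bilin_diff_exp_mult bilin_diff_Shml assms)

text \<open>Only one argument depends on the parameters, so the form acts on their coefficients,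
  which \<open>K_coeff_Xop\<close> identifies as products of two modes.\<close>

lemma bilin_diff_cK_Xop:
  assumes "\<And>m m'. bilin_diff f f m m' = 0"
  shows "bilin_diff (Xop a b f) (\<lambda>m. cK (f m)) m m' + bilin_diff (\<lambda>m. cK (f m)) (Xop a b f) m m' = 0"
proof (rule K_eqI)
  fix i j
  let ?h = "vertex_mode a i (vertex_mode b j f)" and ?f = "\<lambda>m. cK (f m)"
  have eq: "bilin Cmp1 f f m m' = bilin Cmp2 f f m m'" for m m'
    using assms[of m m'] by (simp add: bilin_diff_def)
  have X: "(\<lambda>p. K_coeff i j (Xop a b f p)) = scl (sg j) ?h"
    by (simp add: fun_eq_iff scl_apply K_coeff_Xop)
  have "K_coeff i j (bilin c (Xop a b f) ?f m m' + bilin c ?f (Xop a b f) m m')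
     = sg j * (bilin c ?h f m m' + bilin c f ?h m m')" for c
    unfolding K_coeff_add bilin_commute[of c "Xop a b f"] K_coeff_bilin_cK X bilin_scl_right
      bilin_commute[of c ?h] distrib_left ..
  then have "K_coeff i j (bilin Cmp1 (Xop a b f) ?f m m' + bilin Cmp1 ?f (Xop a b f) m m')
     = K_coeff i j (bilin Cmp2 (Xop a b f) ?f m m' + bilin Cmp2 ?f (Xop a b f) m m')"
    using bilin_pair_symmetric[OF eq, of a i b j m m'] by simp
  then show "K_coeff i j (bilin_diff (Xop a b f) ?f m m' + bilin_diff ?f (Xop a b f) m m') = K_coeff i j 0"
    unfolding bilin_diff_def K_coeff_add K_coeff_diff K_coeff_0 by algebra
qed

theorem mainTheorem6:
  fixes tau :: "complex tser" and a b :: comp and C :: complex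
  assumes "is_2bkp_tau tau"
  shows "is_2bkp_tau (\<lambda>m. cK (tau m) + cK C * Xop a b tau m)"
  unfolding is_2bkp_tau_iff
proof (intro allI)
  fix m m'
  let ?f = "\<lambda>m. cK (tau m)" and ?X = "Xop a b tau"
  have 0: "bilin_diff tau tau m m' = 0" for m m' using assms by (simp add: is_2bkp_tau_iff)
  have "bilin_diff ?f ?f m m' = 0"
    using 0[of m m'] by (simp add: bilin_diff_def bilin_cK)
  moreover have "bilin_diff (?f + scl (cK C) ?X) (?f + scl (cK C) ?X) m m' =
    bilin_diff ?f ?f m m' + cK C * (bilin_diff ?X ?f m m' + bilin_diff ?f ?X m m')
      + cK C * cK C * bilin_diff ?X ?X m m'"
    unfolding bilin_diff_def bilin_add_left bilin_add_right bilin_scl_left bilin_scl_right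
    by (simp add: algebra_simps)
  moreover have "(\<lambda>m. cK (tau m) + cK C * Xop a b tau m) = ?f + scl (cK C) ?X"
    by (simp add: fun_eq_iff plus_fun_apply scl_apply)
  ultimately show "bilin_diff (\<lambda>m. cK (tau m) + cK C * Xop a b tau m)
      (\<lambda>m. cK (tau m) + cK C * Xop a b tau m) m m' = 0"
    by (simp add: bilin_diff_cK_Xop bilin_diff_Xop 0)
qed

end
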